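(* Let $G$ be a finite group and $H$ a normal subgroup of $G$. Then the observable algebra $\mathcal{A}_{(H,G)}=\{F\in\mathcal{F}_H: z_H(F)=F\}$ is the $C^*$-algebra given by the $C^*$-inductive limit $$\mathcal{A}_{(H,G)}=\overline{\bigcup_{\Lambda}\mathcal{A}_H(\Lambda)},$$ where $\Lambda$ runs over the finite subsets of $\frac12\mathbb{Z}$ (directed by inclusion) and the closure is the norm closure in $\mathcal{F}_H$.
   Context: Let $e$ be the unit of $G$. $\delta_{a,b}$ with two group-element indices and no argument is the Kronecker delta. The Hopf $*$-algebra $D(H;G)$: it is the crossed product of $C(H)$ (complex functions on $H$) with the group algebra $\mathbb{C}G$ under the adjoint action. It has linear basis $(h,g)$, $h\in H$, $g\in G$, with multiplication $(h_1,g_1)(h_2,g_2)=\delta_{h_1g_1,g_1h_2}(h_1,g_1g_2)$, unit $\sum_{h\in H}(h,e)$, $(h,g)^*=(g^{-1}hg,g^{-1})$, coproduct $\Delta(h,g)=\sum_{t\in H}(t,g)\otimes(t^{-1}h,g)$, counit $\varepsilon(h,g)=\delta_{h,e}$, antipode $S(h,g)=(g^{-1}h^{-1}g,g^{-1})$. Put $z_H=\frac1{|G|}\sum_{g\in G}(e,g)\in D(H;G)$. The algebra $\mathcal{F}_{H,loc}$: it is the unital associative complex $*$-algebra with unit $I$ generated by $\delta_g(x)$, $\rho_h(l)$ ($g\in G$, $h\in H$, $x\in\mathbb{Z}$, $l\in\mathbb{Z}+\frac12$) subject to: $\sum_{g\in G}\delta_g(x)=I=\rho_e(l)$; $\delta_{g_1}(x)\delta_{g_2}(x)=\delta_{g_1,g_2}\delta_{g_1}(x)$;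 $\rho_{h_1}(l)\rho_{h_2}(l)=\rho_{h_1h_2}(l)$; $\delta_{g_1}(x)\delta_{g_2}(x')=\delta_{g_2}(x')\delta_{g_1}(x)$; $\rho_h(l)\delta_g(x)=\delta_{hg}(x)\rho_h(l)$ if $l<x$ and $\rho_h(l)\delta_g(x)=\delta_g(x)\rho_h(l)$ if $l>x$; $\rho_{h_1}(l)\rho_{h_2}(l')=\rho_{h_2}(l')\rho_{h_2^{-1}h_1h_2}(l)$ if $l>l'$. The involution is determined by $\delta_g(x)^*=\delta_g(x)$, $\rho_h(l)^*=\rho_{h^{-1}}(l)$. For a finite subset $\Lambda\subseteq\frac12\mathbb{Z}$, $\mathcal{F}_H(\Lambda)$ is the unital subalgebra of $\mathcal{F}_{H,loc}$ generated by $\delta_g(x)$, $\rho_h(l)$ with $g\in G$, $h\in H$, $x\in\Lambda\cap\mathbb{Z}$, $l\in\Lambda\cap(\mathbb{Z}+\frac12)$. The field algebra $\mathcal{F}_H$: consider the increasing intervals $\Lambda_{2n}=\{s\in\frac12\mathbb{Z}:-n+\frac12\le s\le n\}$, $\Lambda_{2n+1}=\{s\in\frac12\mathbb{Z}:-n-\frac12\le s\le n\}$. For $H=G$ the $*$-algebra $\mathcal{F}_G(\Lambda_n)$ is isomorphic to the full matrix algebra $M_{|G|^n}(\mathbb{C})$, and $\mathcal{F}_H(\Lambda_n)$ is a $*$-subalgebra of it, hence a finite-dimensional $C^*$-algebra. The inclusions $\mathcal{F}_H(\Lambda_n)\subseteq\mathcal{F}_H(\Lambda_{n+1})$ are norm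 preserving, and $\mathcal{F}_H=\overline{\bigcup_n\mathcal{F}_H(\Lambda_n)}$ is the $C^*$-inductive limit (the $C^*$-completion of $\mathcal{F}_{H,loc}$). Action: $D(H;G)$ acts on $\mathcal{F}_H$; the action is the continuous extension of the one on $\mathcal{F}_{H,loc}$ determined by $(h,g)\delta_f(x)=\delta_{h,e}\,\delta_{gf}(x)$ for $f\in G$, $(h,g)\rho_t(l)=\delta_{h,gtg^{-1}}\,\rho_h(l)$ for $t\in H$, and the module algebra rules $(ab)(F)=a(b(F))$, $a(F_1F_2)=\sum_{(a)}a_{(1)}(F_1)a_{(2)}(F_2)$, $a(I)=\varepsilon(a)I$; it also satisfies $a(F^* )=(S(a^* )(F))^*$. The map $F\mapsto z_H(F)$ denotes the action of the element $z_H$. For $h\in H$, $g\in G$, $x\in\mathbb{Z}$, $l\in\mathbb{Z}+\frac12$: $$v_h(x)=\sum_{f\in G}\rho_{fh^{-1}f^{-1}}(x-\tfrac12)\,\delta_f(x)\,\rho_{fhf^{-1}}(x+\tfrac12),\qquad w_g(l)=\sum_{f\in G}\delta_f(l-\tfrac12)\,\delta_{fg}(l+\tfrac12).$$ For $\Lambda\subseteq\frac12\mathbb{Z}$, $\mathcal{A}_H(\Lambda)$ is the unital subalgebra of $\mathcal{F}_{H,loc}$ generated by $v_h(x)$, $w_g(l)$ with $h\in H$, $g\in G$, $x\in\Lambda\cap\mathbb{Z}$, $l\in\Lambda\cap(\mathbb{Z}+\frac12)$. *)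

theory Defs
  imports
    "HOL-Analysis.Analysis"
    "HOL-Algebra.Coset"
    "HOL-Library.Poly_Mapping"
begin

section \<open>Unital C*-algebras\<close>

class unital_cstar_algebra = real_normed_algebra_1 + banach +
  fixes scaleC :: "complex \<Rightarrow> 'a \<Rightarrow> 'a"  (infixr \<open>*\<^sub>C\<close> 75)
    and adj :: "'a \<Rightarrow> 'a"  (\<open>(_\<^sup>\<star>)\<close> [1000] 999)
  assumes scaleC_add_right: "c *\<^sub>C (x + y) = c *\<^sub>C x + c *\<^sub>C y"
    and scaleC_add_left: "(c + d) *\<^sub>C x = c *\<^sub>C x + d *\<^sub>C x"
    and scaleC_scaleC: "c *\<^sub>C d *\<^sub>C x = (c * d) *\<^sub>C x"
    and scaleR_scaleC: "r *\<^sub>R x = complex_of_real r *\<^sub>C x"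
    and mult_scaleC_left: "(c *\<^sub>C x) * y = c *\<^sub>C (x * y)"
    and mult_scaleC_right: "x * (c *\<^sub>C y) = c *\<^sub>C (x * y)"
    and norm_scaleC: "norm (c *\<^sub>C x) = cmod c * norm x"
    and adj_adj: "(x\<^sup>\<star>)\<^sup>\<star> = x"
    and adj_add: "(x + y)\<^sup>\<star> = x\<^sup>\<star> + y\<^sup>\<star>"
    and adj_scaleC: "(c *\<^sub>C x)\<^sup>\<star> = cnj c *\<^sub>C x\<^sup>\<star>"
    and adj_mult: "(x * y)\<^sup>\<star> = y\<^sup>\<star> * x\<^sup>\<star>"
    and cstar_identity: "norm (x\<^sup>\<star> * x) = (norm x)\<^sup>2"

definition unital_subalgebra :: "'a::unital_cstar_algebra set \<Rightarrow> bool" where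
  "unital_subalgebra S \<longleftrightarrow> 1 \<in> S \<and> (\<forall>x\<in>S. \<forall>y\<in>S. x + y \<in> S \<and> x * y \<in> S) \<and>
     (\<forall>c. \<forall>x\<in>S. c *\<^sub>C x \<in> S)"

definition cstar_subalgebra :: "'a::unital_cstar_algebra set \<Rightarrow> bool" where
  "cstar_subalgebra S \<longleftrightarrow> unital_subalgebra S \<and> (\<forall>x\<in>S. x\<^sup>\<star> \<in> S) \<and> closed S"

text \<open>A directed system of C*-subalgebras of one ambient C*-algebra, indexed by a family of sets
  directed by inclusion. The connecting maps are the inclusions, so they are automatically
  norm preserving *-homomorphisms, and the C*-inductive limit is the norm closure of the union.\<close>

definition cstar_directed_system ::
    "'i set set \<Rightarrow> ('i set \<Rightarrow> 'a::unital_cstar_algebra set) \<Rightarrow> bool" where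
  "cstar_directed_system I A \<longleftrightarrow>
     I \<noteq> {} \<and> (\<forall>L\<in>I. \<forall>M\<in>I. \<exists>N\<in>I. L \<subseteq> N \<and> M \<subseteq> N) \<and>
     (\<forall>L\<in>I. cstar_subalgebra (A L)) \<and>
     (\<forall>L\<in>I. \<forall>M\<in>I. L \<subseteq> M \<longrightarrow> A L \<subseteq> A M)"

definition cstar_inductive_limit ::
    "'i set set \<Rightarrow> ('i set \<Rightarrow> 'a::unital_cstar_algebra set) \<Rightarrow> 'a set" where
  "cstar_inductive_limit I A = closure (\<Union>L\<in>I. A L)"


section \<open>The lattice\<close>

definition half_lattice :: "rat set" where
  "half_lattice = {s. 2 * s \<in> \<int>}"

definition links :: "rat set" where
  "links = {l. l - 1/2 \<in> \<int>}"

definition finite_regions :: "rat set set" where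
  "finite_regions = {\<Lambda>. finite \<Lambda> \<and> \<Lambda> \<subseteq> half_lattice}"

definition interval_even :: "nat \<Rightarrow> rat set" where
  "interval_even n = {s \<in> half_lattice. - of_nat n + 1/2 \<le> s \<and> s \<le> of_nat n}"

definition interval_odd :: "nat \<Rightarrow> rat set" where
  "interval_odd n = {s \<in> half_lattice. - of_nat n - 1/2 \<le> s \<and> s \<le> of_nat n}"

definition interval :: "nat \<Rightarrow> rat set" where
  "interval k = (if even k then interval_even (k div 2) else interval_odd (k div 2))"


section \<open>The presentation of the local field algebra\<close>

text \<open>The free unital complex algebra on a set of letters is the monoid algebra of the free monoid,
  that is, the type of finitely supported functions from words to \<open>complex\<close>. Its
  ring structure is the one of \<open>Poly_Mapping\<close>, for which words have to form an
  additively written monoid under concatenation.\<close>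

instantiation list :: (type) monoid_add
begin
definition zero_list_def: "0 = []"
definition plus_list_def: "xs + ys = xs @ ys"
instance by standard (simp_all add: zero_list_def plus_list_def)
end

datatype 'g gen = Delta 'g rat | Rho 'g rat

type_synonym 'g free = "'g gen list \<Rightarrow>\<^sub>0 complex"

definition gens :: "('g, 'm) monoid_scheme \<Rightarrow> 'g set \<Rightarrow> 'g gen set" where
  "gens G H = {Delta g x | g x. g \<in> carrier G \<and> x \<in> \<int>} \<union> {Rho h l | h l. h \<in> H \<and> l \<in> links}"

definition free_algebra :: "('g, 'm) monoid_scheme \<Rightarrow> 'g set \<Rightarrow> 'g free set" where
  "free_algebra G H = {p. Poly_Mapping.keys p \<subseteq> lists (gens G H)}"

abbreviation \<Delta> :: "'g \<Rightarrow> rat \<Rightarrow> 'g free" where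
  "\<Delta> g x \<equiv> Poly_Mapping.single [Delta g x] 1"

abbreviation \<P> :: "'g \<Rightarrow> rat \<Rightarrow> 'g free" where
  "\<P> h l \<equiv> Poly_Mapping.single [Rho h l] 1"

text \<open>A relation \<open>a = b\<close> is represented by the element \<open>a - b\<close>.\<close>

inductive_set relators :: "('g, 'm) monoid_scheme \<Rightarrow> 'g set \<Rightarrow> 'g free set"
  for G :: "('g, 'm) monoid_scheme" and H :: "'g set" where
  delta_sum: "x \<in> \<int> \<Longrightarrow> (\<Sum>g\<in>carrier G. \<Delta> g x) - 1 \<in> relators G H"
| rho_unit: "l \<in> links \<Longrightarrow> \<P> \<one>\<^bsub>G\<^esub> l - 1 \<in> relators G H"
| delta_orth: "\<lbrakk>g\<^sub>1 \<in> carrier G; g\<^sub>2 \<in> carrier G; x \<in> \<int>\<rbrakk> \<Longrightarrow>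
    \<Delta> g\<^sub>1 x * \<Delta> g\<^sub>2 x - (if g\<^sub>1 = g\<^sub>2 then \<Delta> g\<^sub>1 x else 0) \<in> relators G H"
| rho_mult: "\<lbrakk>h\<^sub>1 \<in> H; h\<^sub>2 \<in> H; l \<in> links\<rbrakk> \<Longrightarrow>
    \<P> h\<^sub>1 l * \<P> h\<^sub>2 l - \<P> (h\<^sub>1 \<otimes>\<^bsub>G\<^esub> h\<^sub>2) l \<in> relators G H"
| delta_commute: "\<lbrakk>g\<^sub>1 \<in> carrier G; g\<^sub>2 \<in> carrier G; x \<in> \<int>; x' \<in> \<int>\<rbrakk> \<Longrightarrow>
    \<Delta> g\<^sub>1 x * \<Delta> g\<^sub>2 x' - \<Delta> g\<^sub>2 x' * \<Delta> g\<^sub>1 x \<in> relators G H"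
| rho_delta_less: "\<lbrakk>h \<in> H; g \<in> carrier G; l \<in> links; x \<in> \<int>; l < x\<rbrakk> \<Longrightarrow>
    \<P> h l * \<Delta> g x - \<Delta> (h \<otimes>\<^bsub>G\<^esub> g) x * \<P> h l \<in> relators G H"
| rho_delta_greater: "\<lbrakk>h \<in> H; g \<in> carrier G; l \<in> links; x \<in> \<int>; l > x\<rbrakk> \<Longrightarrow>
    \<P> h l * \<Delta> g x - \<Delta> g x * \<P> h l \<in> relators G H"
| rho_exchange: "\<lbrakk>h\<^sub>1 \<in> H; h\<^sub>2 \<in> H; l \<in> links; l' \<in> links; l > l'\<rbrakk> \<Longrightarrow>
    \<P> h\<^sub>1 l * \<P> h\<^sub>2 l' - \<P> h\<^sub>2 l' * \<P> (inv\<^bsub>G\<^esub> h\<^sub>2 \<otimes>\<^bsub>G\<^esub> h\<^sub>1 \<otimes>\<^bsub>G\<^esub> h\<^sub>2) l \<in> relators G H"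

text \<open>The two-sided ideal of the free algebra generated by the relators. The scalars lie in the
  free algebra, so the last two rules also give closure under scalar multiplication.\<close>

inductive_set relation_ideal :: "('g, 'm) monoid_scheme \<Rightarrow> 'g set \<Rightarrow> 'g free set"
  for G :: "('g, 'm) monoid_scheme" and H :: "'g set" where
  "0 \<in> relation_ideal G H"
| "r \<in> relators G H \<Longrightarrow> r \<in> relation_ideal G H"
| "\<lbrakk>a \<in> relation_ideal G H; b \<in> relation_ideal G H\<rbrakk> \<Longrightarrow> a + b \<in> relation_ideal G H"
| "\<lbrakk>p \<in> free_algebra G H; a \<in> relation_ideal G H\<rbrakk> \<Longrightarrow> p * a \<in> relation_ideal G H"
| "\<lbrakk>p \<in> free_algebra G H; a \<in> relation_ideal G H\<rbrakk> \<Longrightarrow> a * p \<in> relation_ideal G H"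

primrec gen_value :: "('g \<Rightarrow> rat \<Rightarrow> 'a) \<Rightarrow> ('g \<Rightarrow> rat \<Rightarrow> 'a) \<Rightarrow> 'g gen \<Rightarrow> 'a" where
  "gen_value \<delta> \<rho> (Delta g x) = \<delta> g x"
| "gen_value \<delta> \<rho> (Rho h l) = \<rho> h l"

definition free_eval ::
    "('g \<Rightarrow> rat \<Rightarrow> 'a::unital_cstar_algebra) \<Rightarrow> ('g \<Rightarrow> rat \<Rightarrow> 'a) \<Rightarrow> 'g free \<Rightarrow> 'a" where
  "free_eval \<delta> \<rho> p =
     (\<Sum>w\<in>Poly_Mapping.keys p. Poly_Mapping.lookup p w *\<^sub>C prod_list (map (gen_value \<delta> \<rho>) w))"


section \<open>The field algebra\<close>

definition field_local ::
    "('g, 'm) monoid_scheme \<Rightarrow> 'g set \<Rightarrow> ('g \<Rightarrow> rat \<Rightarrow> 'a::unital_cstar_algebra) \<Rightarrow> ('g \<Rightarrow> rat \<Rightarrow> 'a)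
      \<Rightarrow> rat set \<Rightarrow> 'a set" where
  "field_local G H \<delta> \<rho> \<Lambda> = unital_subalgebra hull
     ({\<delta> g x | g x. g \<in> carrier G \<and> x \<in> \<Lambda> \<inter> \<int>} \<union> {\<rho> h l | h l. h \<in> H \<and> l \<in> \<Lambda> \<inter> links})"

text \<open>The C*-algebra \<open>'a\<close>, together with the families \<open>\<delta>\<close> and \<open>\<rho>\<close> in it,
  is the field algebra of \<open>(H, G)\<close>:

  \<^item> \<open>free_eval \<delta> \<rho>\<close> has kernel exactly the ideal of relations, so it induces an
    embedding into \<open>'a\<close> of the local field algebra (the free algebra modulo that ideal), which we
    identify with its image;
  \<^item> this embedding is a *-homomorphism;
  \<^item> the image, which is the increasing union of the algebras of the intervals, is dense.

  The algebra of each interval is a finite-dimensional C*-algebra, whose C*-norm is unique, so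
  the embedding is norm preserving on it. Hence these conditions say that \<open>'a\<close> is
  the C*-inductive limit of the algebras of the intervals, an object determined up to a unique
  *-isomorphism respecting the generators.\<close>

definition is_field_algebra ::
    "('g, 'm) monoid_scheme \<Rightarrow> 'g set \<Rightarrow> ('g \<Rightarrow> rat \<Rightarrow> 'a::unital_cstar_algebra) \<Rightarrow> ('g \<Rightarrow> rat \<Rightarrow> 'a)
      \<Rightarrow> bool" where
  "is_field_algebra G H \<delta> \<rho> \<longleftrightarrow>
     (\<forall>p\<in>free_algebra G H. free_eval \<delta> \<rho> p = 0 \<longleftrightarrow> p \<in> relation_ideal G H) \<and>
     (\<forall>g\<in>carrier G. \<forall>x\<in>\<int>. (\<delta> g x)\<^sup>\<star> = \<delta> g x) \<and>
     (\<forall>h\<in>H. \<forall>l\<in>links. (\<rho> h l)\<^sup>\<star> = \<rho> (inv\<^bsub>G\<^esub> h) l) \<and>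
     closure (\<Union>n. field_local G H \<delta> \<rho> (interval n)) = UNIV"


section \<open>The Hopf *-algebra \<open>D(H;G)\<close>\<close>

text \<open>An element of \<open>D(H;G)\<close> is the function of its coefficients with respect to the basis
  \<open>H \<times> carrier G\<close>; an element of the tensor square is the function of its
  coefficients with respect to pairs of basis elements.\<close>

type_synonym 'g dbl = "'g \<times> 'g \<Rightarrow> complex"

definition dbl_carrier :: "('g, 'm) monoid_scheme \<Rightarrow> 'g set \<Rightarrow> 'g dbl set" where
  "dbl_carrier G H = {a. \<forall>p. p \<notin> H \<times> carrier G \<longrightarrow> a p = 0}"

definition dbl_basis :: "'g \<times> 'g \<Rightarrow> 'g dbl" where
  "dbl_basis p = (\<lambda>q. if q = p then 1 else 0)"

definition dbl_mult :: "('g, 'm) monoid_scheme \<Rightarrow> 'g set \<Rightarrow> 'g dbl \<Rightarrow> 'g dbl \<Rightarrow> 'g dbl" where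
  "dbl_mult G H a b = (\<lambda>q. \<Sum>(h\<^sub>1, g\<^sub>1)\<in>H \<times> carrier G. \<Sum>(h\<^sub>2, g\<^sub>2)\<in>H \<times> carrier G.
     a (h\<^sub>1, g\<^sub>1) * b (h\<^sub>2, g\<^sub>2) *
     (if h\<^sub>1 \<otimes>\<^bsub>G\<^esub> g\<^sub>1 = g\<^sub>1 \<otimes>\<^bsub>G\<^esub> h\<^sub>2 then dbl_basis (h\<^sub>1, g\<^sub>1 \<otimes>\<^bsub>G\<^esub> g\<^sub>2) q else 0))"

definition dbl_unit :: "('g, 'm) monoid_scheme \<Rightarrow> 'g set \<Rightarrow> 'g dbl" where
  "dbl_unit G H = (\<lambda>q. \<Sum>h\<in>H. dbl_basis (h, \<one>\<^bsub>G\<^esub>) q)"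

definition dbl_star :: "('g, 'm) monoid_scheme \<Rightarrow> 'g set \<Rightarrow> 'g dbl \<Rightarrow> 'g dbl" where
  "dbl_star G H a = (\<lambda>q. \<Sum>(h, g)\<in>H \<times> carrier G.
     cnj (a (h, g)) * dbl_basis (inv\<^bsub>G\<^esub> g \<otimes>\<^bsub>G\<^esub> h \<otimes>\<^bsub>G\<^esub> g, inv\<^bsub>G\<^esub> g) q)"

definition dbl_comult ::
    "('g, 'm) monoid_scheme \<Rightarrow> 'g set \<Rightarrow> 'g dbl \<Rightarrow> ('g \<times> 'g) \<times> ('g \<times> 'g) \<Rightarrow> complex" where
  "dbl_comult G H a = (\<lambda>(p, q). \<Sum>(h, g)\<in>H \<times> carrier G.
     a (h, g) * (\<Sum>t\<in>H. dbl_basis (t, g) p * dbl_basis (inv\<^bsub>G\<^esub> t \<otimes>\<^bsub>G\<^esub> h, g) q))"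

definition dbl_counit :: "('g, 'm) monoid_scheme \<Rightarrow> 'g set \<Rightarrow> 'g dbl \<Rightarrow> complex" where
  "dbl_counit G H a = (\<Sum>(h, g)\<in>H \<times> carrier G. a (h, g) * (if h = \<one>\<^bsub>G\<^esub> then 1 else 0))"

definition dbl_antipode :: "('g, 'm) monoid_scheme \<Rightarrow> 'g set \<Rightarrow> 'g dbl \<Rightarrow> 'g dbl" where
  "dbl_antipode G H a = (\<lambda>q. \<Sum>(h, g)\<in>H \<times> carrier G.
     a (h, g) * dbl_basis (inv\<^bsub>G\<^esub> g \<otimes>\<^bsub>G\<^esub> inv\<^bsub>G\<^esub> h \<otimes>\<^bsub>G\<^esub> g, inv\<^bsub>G\<^esub> g) q)"

definition z_elt :: "('g, 'm) monoid_scheme \<Rightarrow> 'g dbl" where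
  "z_elt G = (\<lambda>q. 1 / of_nat (card (carrier G)) * (\<Sum>g\<in>carrier G. dbl_basis (\<one>\<^bsub>G\<^esub>, g) q))"


section \<open>The action on the field algebra\<close>

text \<open>These conditions determine \<open>act a\<close> for \<open>a\<close> in \<open>dbl_carrier G H\<close>:
  the algebraic ones fix it on the local field algebra, which is dense, and \<open>act a\<close> is continuous.\<close>

definition is_field_action ::
    "('g, 'm) monoid_scheme \<Rightarrow> 'g set \<Rightarrow> ('g \<Rightarrow> rat \<Rightarrow> 'a::unital_cstar_algebra) \<Rightarrow> ('g \<Rightarrow> rat \<Rightarrow> 'a)
      \<Rightarrow> ('g dbl \<Rightarrow> 'a \<Rightarrow> 'a) \<Rightarrow> bool" where
  "is_field_action G H \<delta> \<rho> act \<longleftrightarrow>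
     \<comment> \<open>continuous module structure\<close>
     (\<forall>a\<in>dbl_carrier G H. continuous_on UNIV (act a)) \<and>
     (\<forall>a\<in>dbl_carrier G H. \<forall>F\<^sub>1 F\<^sub>2. act a (F\<^sub>1 + F\<^sub>2) = act a F\<^sub>1 + act a F\<^sub>2) \<and>
     (\<forall>a\<in>dbl_carrier G H. \<forall>c F. act a (c *\<^sub>C F) = c *\<^sub>C act a F) \<and>
     (\<forall>a\<in>dbl_carrier G H. \<forall>b\<in>dbl_carrier G H. \<forall>F. act (\<lambda>p. a p + b p) F = act a F + act b F) \<and>
     (\<forall>a\<in>dbl_carrier G H. \<forall>c F. act (\<lambda>p. c * a p) F = c *\<^sub>C act a F) \<and>
     (\<forall>a\<in>dbl_carrier G H. \<forall>b\<in>dbl_carrier G H. \<forall>F. act (dbl_mult G H a b) F = act a (act b F)) \<and>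
     (\<forall>F. act (dbl_unit G H) F = F) \<and>
     \<comment> \<open>compatibility with product, unit and involution of the field algebra\<close>
     (\<forall>a\<in>dbl_carrier G H. \<forall>F\<^sub>1 F\<^sub>2. act a (F\<^sub>1 * F\<^sub>2) =
        (\<Sum>p\<in>H \<times> carrier G. \<Sum>q\<in>H \<times> carrier G.
           dbl_comult G H a (p, q) *\<^sub>C (act (dbl_basis p) F\<^sub>1 * act (dbl_basis q) F\<^sub>2))) \<and>
     (\<forall>a\<in>dbl_carrier G H. act a 1 = dbl_counit G H a *\<^sub>C 1) \<and>
     (\<forall>a\<in>dbl_carrier G H. \<forall>F. act a (F\<^sup>\<star>) = (act (dbl_antipode G H (dbl_star G H a)) F)\<^sup>\<star>) \<and>
     \<comment> \<open>values on the generators\<close>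
     (\<forall>h\<in>H. \<forall>g\<in>carrier G. \<forall>f\<in>carrier G. \<forall>x\<in>\<int>.
        act (dbl_basis (h, g)) (\<delta> f x) = (if h = \<one>\<^bsub>G\<^esub> then \<delta> (g \<otimes>\<^bsub>G\<^esub> f) x else 0)) \<and>
     (\<forall>h\<in>H. \<forall>g\<in>carrier G. \<forall>t\<in>H. \<forall>l\<in>links.
        act (dbl_basis (h, g)) (\<rho> t l) =
          (if h = g \<otimes>\<^bsub>G\<^esub> t \<otimes>\<^bsub>G\<^esub> inv\<^bsub>G\<^esub> g then \<rho> h l else 0))"


section \<open>Observables\<close>

definition observable_algebra ::
    "('g, 'm) monoid_scheme \<Rightarrow> ('g dbl \<Rightarrow> 'a \<Rightarrow> 'a) \<Rightarrow> 'a set" where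
  "observable_algebra G act = {F. act (z_elt G) F = F}"

definition v_op ::
    "('g, 'm) monoid_scheme \<Rightarrow> ('g \<Rightarrow> rat \<Rightarrow> 'a::unital_cstar_algebra) \<Rightarrow> ('g \<Rightarrow> rat \<Rightarrow> 'a)
      \<Rightarrow> 'g \<Rightarrow> rat \<Rightarrow> 'a" where
  "v_op G \<delta> \<rho> h x = (\<Sum>f\<in>carrier G.
     \<rho> (f \<otimes>\<^bsub>G\<^esub> inv\<^bsub>G\<^esub> h \<otimes>\<^bsub>G\<^esub> inv\<^bsub>G\<^esub> f) (x - 1/2) * \<delta> f x *
     \<rho> (f \<otimes>\<^bsub>G\<^esub> h \<otimes>\<^bsub>G\<^esub> inv\<^bsub>G\<^esub> f) (x + 1/2))"

definition w_op ::
    "('g, 'm) monoid_scheme \<Rightarrow> ('g \<Rightarrow> rat \<Rightarrow> 'a::unital_cstar_algebra) \<Rightarrow> 'g \<Rightarrow> rat \<Rightarrow> 'a" where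
  "w_op G \<delta> g l = (\<Sum>f\<in>carrier G. \<delta> f (l - 1/2) * \<delta> (f \<otimes>\<^bsub>G\<^esub> g) (l + 1/2))"

definition observable_local ::
    "('g, 'm) monoid_scheme \<Rightarrow> 'g set \<Rightarrow> ('g \<Rightarrow> rat \<Rightarrow> 'a::unital_cstar_algebra) \<Rightarrow> ('g \<Rightarrow> rat \<Rightarrow> 'a)
      \<Rightarrow> rat set \<Rightarrow> 'a set" where
  "observable_local G H \<delta> \<rho> \<Lambda> = unital_subalgebra hull
     ({v_op G \<delta> \<rho> h x | h x. h \<in> H \<and> x \<in> \<Lambda> \<inter> \<int>} \<union>
      {w_op G \<delta> g l | g l. g \<in> carrier G \<and> l \<in> \<Lambda> \<inter> links})"

end

theory Submission
  imports Defs
begin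

text \<open>
  A generator of the field algebra is covariant under \<open>D(H;G)\<close>: it is homogeneous for the
  \<open>H\<close>-grading given by \<open>C(H)\<close>, and \<open>G\<close> permutes the generators.  A field is fixed by \<open>z\<^sub>H\<close>
  iff it has degree \<open>e\<close> and is fixed by \<open>G\<close>; the operators \<open>v\<^sub>h(x)\<close> and \<open>w\<^sub>g(l)\<close> are of this kind.

  Conversely, fix a site \<open>a\<close>.  The identities
  \<open>\<delta>\<^sub>g(x + 1) = \<Sum>\<^sub>f \<delta>\<^sub>f(x) w\<^bsub>f\<inverse>g\<^esub>(x + 1/2)\<close> and
  \<open>\<rho>\<^sub>k(x + 1/2) = \<rho>\<^sub>k(x - 1/2) \<Sum>\<^sub>f \<delta>\<^sub>f(x) v\<^bsub>f\<inverse>kf\<^esub>(x)\<close> express all fields to the right of \<open>a\<close>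
  through \<open>\<delta>\<^sub>f(a)\<close>, \<open>\<rho>\<^sub>h(a - 1/2)\<close> and local observables, and commuting the observables
  to the right writes each of them as a sum of terms \<open>\<delta>\<^sub>f(a) \<rho>\<^sub>h(a - 1/2) \<alpha>\<close> with \<open>\<alpha>\<close> a local observable.
  Such a term is mapped by \<open>z\<^sub>H\<close> to a multiple of \<open>\<alpha>\<close>, so \<open>z\<^sub>H\<close> maps local fields to
  local observables, and the theorem follows by density and continuity.  Each local algebra is closed because
  it lies in the span of finitely many normally ordered words.
\<close>

section \<open>C*-algebras and finite-dimensional subalgebras\<close>

lemma scaleC_zero_left [simp]: "0 *\<^sub>C (x::'a::unital_cstar_algebra) = 0"
  using scaleC_add_left[of 0 0 x] by simp

lemma scaleC_zero_right [simp]: "c *\<^sub>C (0::'a::unital_cstar_algebra) = 0"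
  using scaleC_add_right[of c 0 "0::'a"] by simp

lemma scaleC_one [simp]: "1 *\<^sub>C (x::'a::unital_cstar_algebra) = x"
  using scaleR_scaleC[of 1 x] by simp

lemma scaleC_minus_one: "(-1) *\<^sub>C (x::'a::unital_cstar_algebra) = - x"
  using scaleR_scaleC[of "-1" x] by simp

lemma scaleC_sum_left: "sum f A *\<^sub>C (x::'a::unital_cstar_algebra) = (\<Sum>i\<in>A. f i *\<^sub>C x)"
  by (induction A rule: infinite_finite_induct) (simp_all add: scaleC_add_left)

lemma adj_zero [simp]: "(0::'a::unital_cstar_algebra)\<^sup>\<star> = 0"
  using adj_add[of 0 "0::'a"] by simp

lemma adj_one [simp]: "(1::'a::unital_cstar_algebra)\<^sup>\<star> = 1"
  by (metis adj_adj adj_mult mult.left_neutral mult.right_neutral)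

lemma adj_minus: "(- x)\<^sup>\<star> = - (x::'a::unital_cstar_algebra)\<^sup>\<star>"
  using adj_scaleC[of "-1" x] by (simp add: scaleC_minus_one)

lemma adj_sum: "(sum f A)\<^sup>\<star> = (\<Sum>i\<in>A. (f i::'a::unital_cstar_algebra)\<^sup>\<star>)"
  by (induction A rule: infinite_finite_induct) (simp_all add: adj_add)

text \<open>The C*-identity and submultiplicativity give
  \<open>norm y ^ 2 \<le> norm (y\<^sup>\<star>) * norm y\<close>; this is applied to
  \<open>x\<close> and to its adjoint. It makes the involution isometric, hence continuous.\<close>

lemma norm_adj: "norm ((x::'a::unital_cstar_algebra)\<^sup>\<star>) = norm x"
proof -
  have *: "norm y \<le> norm (y\<^sup>\<star>)" for y :: 'a
  proof (cases "y = 0")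
    case False
    have "norm y * norm y \<le> norm (y\<^sup>\<star>) * norm y"
      using norm_mult_ineq[of "y\<^sup>\<star>" y] by (simp add: cstar_identity power2_eq_square)
    then show ?thesis using False by simp
  qed simp
  from *[of x] *[of "x\<^sup>\<star>"] show ?thesis by (simp add: adj_adj)
qed

lemma continuous_on_adj: "continuous_on S (adj :: 'a::unital_cstar_algebra \<Rightarrow> 'a)"
proof (rule continuous_onI)
  fix x :: 'a and e :: real
  assume "0 < e"
  moreover have "dist (y\<^sup>\<star>) (x\<^sup>\<star>) = dist y x" for y
    using norm_adj[of "y - x"] adj_add[of y "- x"] by (simp add: dist_norm adj_minus)
  ultimately show "\<exists>d>0. \<forall>y\<in>S. dist y x < d \<longrightarrow> dist (y\<^sup>\<star>) (x\<^sup>\<star>) \<le> e"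
    by (metis less_eq_real_def)
qed

section \<open>Unital subalgebras generated by a set\<close>

lemma unital_subalgebra_hull: "unital_subalgebra (unital_subalgebra hull X)"
  by (rule hull_in) (auto simp: unital_subalgebra_def)

lemma unital_subalgebraD:
  assumes "unital_subalgebra S"
  shows "1 \<in> S" and "x \<in> S \<Longrightarrow> y \<in> S \<Longrightarrow> x + y \<in> S" and "x \<in> S \<Longrightarrow> y \<in> S \<Longrightarrow> x * y \<in> S"
    and "x \<in> S \<Longrightarrow> c *\<^sub>C x \<in> S"
  using assms by (auto simp: unital_subalgebra_def)

lemma unital_subalgebra_zero: "unital_subalgebra S \<Longrightarrow> 0 \<in> S"
  using unital_subalgebraD(1)[of S] unital_subalgebraD(4)[of S 1 0] by simp

lemma unital_subalgebra_sum:
  "unital_subalgebra S \<Longrightarrow> (\<And>i. i \<in> A \<Longrightarrow> f i \<in> S) \<Longrightarrow> sum f A \<in> S"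
  by (induction A rule: infinite_finite_induct)
    (simp_all add: unital_subalgebra_zero unital_subalgebraD)

lemma unital_subalgebra_subspace: "unital_subalgebra S \<Longrightarrow> subspace S"
  by (rule subspaceI) (simp_all add: unital_subalgebra_zero unital_subalgebraD scaleR_scaleC)

text \<open>The elements whose adjoint lies in the hull form a unital subalgebra containing
  \<open>X\<close>, so they exhaust the hull.\<close>

lemma adj_mem_hull:
  assumes "\<And>x. x \<in> X \<Longrightarrow> x\<^sup>\<star> \<in> X" and "y \<in> unital_subalgebra hull X"
  shows "y\<^sup>\<star> \<in> unital_subalgebra hull X"
proof -
  let ?S = "unital_subalgebra hull X"
  have "?S \<subseteq> {y. y\<^sup>\<star> \<in> ?S}"
  proof (rule hull_minimal)
    show "X \<subseteq> {y. y\<^sup>\<star> \<in> ?S}" using assms(1) by (auto intro: hull_inc)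
    show "unital_subalgebra {y. y\<^sup>\<star> \<in> ?S}"
      using unital_subalgebraD[OF unital_subalgebra_hull[of X]]
      by (simp add: unital_subalgebra_def adj_add adj_mult adj_scaleC)
  qed
  then show ?thesis using assms(2) by auto
qed

section \<open>Closedness of finite-dimensional subspaces\<close>

text \<open>If \<open>a\<close> has positive distance from \<open>S\<close>, the coefficient of
  \<open>a\<close> is bounded by a multiple of the norm. Along a convergent sequence the
  coefficients are therefore Cauchy in the reals, and their limit gives the decomposition of the
  limit vector. Only completeness of the reals enters.\<close>

lemma closed_subspace_insert:
  fixes a :: "'a::real_normed_vector"
  assumes S: "subspace S" "closed S"
  shows "closed {x. \<exists>k. x - k *\<^sub>R a \<in> S}"
proof (cases "a \<in> S")
  case True
  have "{x. \<exists>k. x - k *\<^sub>R a \<in> S} = S" (is "?L = S")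
  proof
    show "?L \<subseteq> S"
    proof clarify
      fix x k assume "x - k *\<^sub>R a \<in> S"
      then show "x \<in> S"
        using subspace_add[OF S(1) _ subspace_scale[OF S(1) True, of k]] by fastforce
    qed
    show "S \<subseteq> ?L" by (auto intro: exI[of _ 0])
  qed
  then show ?thesis using S by simp
next
  case False
  moreover have "open (- S)" using S(2) by (simp add: closed_def)
  ultimately obtain e where e0: "e > 0" "ball a e \<subseteq> - S"
    unfolding open_contains_ball by blast
  have e: "e \<le> dist s a" if "s \<in> S" for s
    using e0 that by (auto simp: dist_commute not_less[symmetric])
  \<comment> \<open>\<open>e\<close> is a lower bound for the distance from \<open>a\<close> to
    \<open>S\<close>. Dividing \<open>x - c *\<^sub>R a\<close> by \<open>c\<close> produces a point
    of \<open>S\<close> to which this bound is applied.\<close>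
  have bound: "\<bar>c\<bar> * e \<le> norm x" if x: "x - c *\<^sub>R a \<in> S" for x c
  proof (cases "c = 0")
    case False
    have "- ((1/c) *\<^sub>R (x - c *\<^sub>R a)) \<in> S"
      using S(1) x by (intro subspace_neg subspace_scale)
    from e[OF this] have "e \<le> norm ((1/c) *\<^sub>R x)"
      using False by (simp add: dist_norm algebra_simps norm_minus_commute)
    then show ?thesis using False by (simp add: field_simps)
  qed simp
  show ?thesis
    unfolding closed_sequential_limits
  proof (intro allI impI, elim conjE)
    fix x l assume "\<forall>n. x n \<in> {x. \<exists>k. x - k *\<^sub>R a \<in> S}" and lim: "x \<longlonglongrightarrow> l"
    then obtain k where k: "\<And>n. x n - k n *\<^sub>R a \<in> S" by simp metis
    have kb: "\<bar>k m - k n\<bar> * e \<le> norm (x m - x n)" for m n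
      using subspace_diff[OF S(1) k[of m] k[of n]] by (intro bound) (simp add: algebra_simps)
    have "Cauchy k"
    proof (rule CauchyI)
      fix r :: real assume "0 < r"
      then have "0 < r * e" using e0(1) by simp
      with LIMSEQ_imp_Cauchy[OF lim] obtain N where N: "\<forall>m\<ge>N. \<forall>n\<ge>N. norm (x m - x n) < r * e"
        using CauchyD by blast
      have "norm (k m - k n) < r" if "m \<ge> N" "n \<ge> N" for m n
      proof -
        have "\<bar>k m - k n\<bar> * e < r * e" using N that kb[of m n] by (meson le_less_trans)
        then show ?thesis using e0(1) by simp
      qed
      then show "\<exists>N. \<forall>m\<ge>N. \<forall>n\<ge>N. norm (k m - k n) < r" by blast
    qed
    then obtain c where c: "k \<longlonglongrightarrow> c" using Cauchy_convergent convergent_def by blast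
    have "(\<lambda>n. x n - k n *\<^sub>R a) \<longlonglongrightarrow> l - c *\<^sub>R a" by (intro tendsto_intros lim c)
    then have "l - c *\<^sub>R a \<in> S" using closed_sequentially[OF S(2), of "\<lambda>n. x n - k n *\<^sub>R a"] k by metis
    then show "l \<in> {x. \<exists>k. x - k *\<^sub>R a \<in> S}" by blast
  qed
qed

lemma closed_span_finite:
  fixes B :: "'a::real_normed_vector set"
  assumes "finite B" shows "closed (span B)"
  using assms
  by (induction B) (simp_all add: span_insert closed_subspace_insert)

text \<open>\<open>T\<close> may lie outside \<open>S\<close>, so \<open>S\<close> gets a basis of
  its own; it is finite because independent subsets of \<open>span T\<close> are.\<close>

lemma closed_subspace_finite_dim:
  fixes S :: "'a::real_normed_vector set"
  assumes "subspace S" and "finite T" and "S \<subseteq> span T"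
  shows "closed S"
proof -
  obtain B where B: "B \<subseteq> S" "independent B" "S \<subseteq> span B"
    using maximal_independent_subset by blast
  then have "finite B" using independent_span_bound[OF assms(2)] assms(3) by blast
  moreover have "span B = S" using B assms(1) by (simp add: span_minimal subset_antisym)
  ultimately show ?thesis using closed_span_finite by metis
qed

section \<open>Adjoining generators without losing finite dimension\<close>

lemma span_mult_left:
  fixes y :: "'a::real_algebra"
  assumes "\<And>t. t \<in> T \<Longrightarrow> y * t \<in> span U" and "x \<in> span T"
  shows "y * x \<in> span U"
  using assms(2)
  by (induction rule: span_induct_alt)
    (simp_all add: span_zero distrib_left span_add span_scale assms(1))

lemma span_mult_right:
  fixes y :: "'a::real_algebra"
  assumes "\<And>t. t \<in> T \<Longrightarrow> t * y \<in> span U" and "x \<in> span T"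
  shows "x * y \<in> span U"
  using assms(2)
  by (induction rule: span_induct_alt)
    (simp_all add: span_zero distrib_right span_add span_scale assms(1))

text \<open>Each letter of \<open>S\<close> can be moved to the right of each letter of
  \<open>X\<close>, at the price of changing both letters. Hence every element is a combination of
  ordered products \<open>b * s\<close> with \<open>b\<close> generated by \<open>X\<close> and
  \<open>s\<close> in \<open>S\<close>, and these lie in the span of the finitely many
  \<open>t * s\<close>.\<close>

lemma finite_dim_extend:
  fixes X S T :: "'a::unital_cstar_algebra set"
  assumes T: "finite T" "unital_subalgebra hull X \<subseteq> span T"
    and S: "finite S" "1 \<in> span S" "\<And>s s'. s \<in> S \<Longrightarrow> s' \<in> S \<Longrightarrow> s * s' \<in> span S"
    and comm: "\<And>s x. s \<in> S \<Longrightarrow> x \<in> X \<Longrightarrow> \<exists>x'\<in>X. \<exists>s'\<in>S. s * x = x' * s'"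
  shows "\<exists>T'. finite T' \<and> unital_subalgebra hull (X \<union> S) \<subseteq> span T'"
proof -
  let ?B = "unital_subalgebra hull X"
  note B = unital_subalgebraD[OF unital_subalgebra_hull[of X]]
  \<comment> \<open>\<open>C\<close> is the real span of the ordered products. It is shown to be
    stable under \<open>?B\<close> from the left and \<open>S\<close> from the right, and then to be
    an algebra.\<close>
  define C where "C = span {b * s | b s. b \<in> ?B \<and> s \<in> S}"
  have C_I: "b * s \<in> C" if "b \<in> ?B" "s \<in> S" for b s
    unfolding C_def using that by (intro span_base) auto
  have BspanS: "b * s \<in> C" if "b \<in> ?B" "s \<in> span S" for b s
    unfolding C_def by (rule span_mult_left[OF _ that(2)]) (use C_I that(1) in \<open>auto simp: C_def\<close>)
  have BC: "b * c \<in> C" if "b \<in> ?B" "c \<in> C" for b c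
    unfolding C_def
  proof (rule span_mult_left)
    fix t assume "t \<in> {b * s | b s. b \<in> ?B \<and> s \<in> S}"
    then obtain b' s where "t = b' * s" "b' \<in> ?B" "s \<in> S" by auto
    then show "b * t \<in> span {b * s | b s. b \<in> ?B \<and> s \<in> S}"
      using C_I[of "b * b'" s] B(3)[OF that(1)] by (simp add: mult.assoc C_def)
  qed (use that in \<open>simp add: C_def\<close>)
  have CS: "c * s \<in> C" if "c \<in> C" "s \<in> S" for c s
    unfolding C_def
  proof (rule span_mult_right)
    fix t assume "t \<in> {b * s | b s. b \<in> ?B \<and> s \<in> S}"
    then obtain b' s' where "t = b' * s'" "b' \<in> ?B" "s' \<in> S" by auto
    then show "t * s \<in> span {b * s | b s. b \<in> ?B \<and> s \<in> S}"
      using BspanS[of b' "s' * s"] S(3)[of s' s] that by (simp add: mult.assoc C_def)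
  qed (use that in \<open>simp add: C_def\<close>)
  \<comment> \<open>\<open>span\<close> only provides real scalars; a complex scalar acts as left
    multiplication by an element of \<open>?B\<close>.\<close>
  have C_scale: "c *\<^sub>C x \<in> C" if "x \<in> C" for c x
    using BC[OF B(4)[OF B(1)] that, of c] by (simp add: mult_scaleC_left)
  have C_add: "x + y \<in> C" if "x \<in> C" "y \<in> C" for x y
    using that by (simp add: C_def span_add)
  \<comment> \<open>The commutation hypothesis concerns generators only. It extends to products
    because all \<open>s\<close> are treated at once: moving \<open>s\<close> past the first factor
    may replace it by another element of \<open>S\<close>.\<close>
  have SB: "\<forall>s\<in>S. s * b \<in> C" if "b \<in> ?B" for b
  proof -
    have "?B \<subseteq> {b\<in>?B. \<forall>s\<in>S. s * b \<in> C}"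
    proof (rule hull_minimal)
      show "X \<subseteq> {b\<in>?B. \<forall>s\<in>S. s * b \<in> C}"
      proof safe
        fix x s assume "x \<in> X" "s \<in> S"
        with comm obtain x' s' where "x' \<in> X" "s' \<in> S" "s * x = x' * s'" by blast
        then show "s * x \<in> C" using C_I[of x' s'] hull_inc[of x' X] by auto
      qed (simp add: hull_inc)
      have mult: "s * (b1 * b2) \<in> C"
        if *: "s * b1 \<in> C" "\<forall>s\<in>S. s * b2 \<in> C" "b2 \<in> ?B" for s b1 b2
      proof -
        have "(s * b1) * b2 \<in> span {b * s | b s. b \<in> ?B \<and> s \<in> S}"
        proof (rule span_mult_right)
          fix t assume "t \<in> {b * s | b s. b \<in> ?B \<and> s \<in> S}"
          then obtain b' s' where "t = b' * s'" "b' \<in> ?B" "s' \<in> S" by auto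
          then show "t * b2 \<in> span {b * s | b s. b \<in> ?B \<and> s \<in> S}"
            using BC[of b' "s' * b2"] * by (simp add: mult.assoc C_def)
        qed (use * in \<open>simp add: C_def\<close>)
        then show ?thesis by (simp add: C_def mult.assoc)
      qed
      have one: "s * 1 \<in> C" if "s \<in> S" for s using C_I[OF B(1) that] by simp
      show "unital_subalgebra {b\<in>?B. \<forall>s\<in>S. s * b \<in> C}"
        using B one mult C_add C_scale
        by (simp add: unital_subalgebra_def distrib_left mult_scaleC_right)
    qed
    then show ?thesis using that by blast
  qed
  have CC: "c * c' \<in> C" if "c \<in> C" "c' \<in> C" for c c'
    unfolding C_def
  proof (rule span_mult_left)
    fix t assume "t \<in> {b * s | b s. b \<in> ?B \<and> s \<in> S}"
    then obtain b' s' where t: "t = b' * s'" "b' \<in> ?B" "s' \<in> S" by auto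
    have "c * b' \<in> span {b * s | b s. b \<in> ?B \<and> s \<in> S}"
    proof (rule span_mult_right)
      fix u assume "u \<in> {b * s | b s. b \<in> ?B \<and> s \<in> S}"
      then obtain b s where "u = b * s" "b \<in> ?B" "s \<in> S" by auto
      then show "u * b' \<in> span {b * s | b s. b \<in> ?B \<and> s \<in> S}"
        using BC[of b "s * b'"] SB[OF t(2)] by (simp add: mult.assoc C_def)
    qed (use that in \<open>simp add: C_def\<close>)
    then show "c * t \<in> span {b * s | b s. b \<in> ?B \<and> s \<in> S}"
      using CS[of "c * b'" s'] t by (simp add: mult.assoc C_def)
  qed (use that in \<open>simp add: C_def\<close>)
  have "unital_subalgebra hull (X \<union> S) \<subseteq> C"
  proof (rule hull_minimal)
    show "X \<union> S \<subseteq> C"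
    proof
      fix y assume "y \<in> X \<union> S"
      then show "y \<in> C"
        using BspanS[OF hull_inc[of y X] S(2)] C_I[OF B(1), of y] by auto
    qed
    show "unital_subalgebra C"
      using CC C_add C_scale BspanS[OF B(1) S(2)] by (simp add: unital_subalgebra_def)
  qed
  also have "C \<subseteq> span {t * s | t s. t \<in> T \<and> s \<in> S}"
    unfolding C_def
  proof (rule span_minimal)
    show "{b * s | b s. b \<in> ?B \<and> s \<in> S} \<subseteq> span {t * s | t s. t \<in> T \<and> s \<in> S}"
    proof safe
      fix b s assume bs: "b \<in> ?B" "s \<in> S"
      show "b * s \<in> span {t * s | t s. t \<in> T \<and> s \<in> S}"
      proof (rule span_mult_right)
        fix t assume "t \<in> T"
        then show "t * s \<in> span {t * s | t s. t \<in> T \<and> s \<in> S}"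
          using bs(2) by (intro span_base) blast
      qed (use T(2) bs(1) in blast)
    qed
  qed simp
  finally have "unital_subalgebra hull (X \<union> S) \<subseteq> span {t * s | t s. t \<in> T \<and> s \<in> S}" .
  moreover have "finite {t * s | t s. t \<in> T \<and> s \<in> S}"
    by (rule finite_image_set2) (use T S in auto)
  ultimately show ?thesis by blast
qed

section \<open>Relations of the field algebra\<close>

text \<open>Allows two elements to be evaluated over a common finite set of words, where additivity
  holds term by term.\<close>

lemma free_eval_superset:
  assumes "finite A" and "Poly_Mapping.keys p \<subseteq> A"
  shows "free_eval \<delta> \<rho> p
    = (\<Sum>w\<in>A. Poly_Mapping.lookup p w *\<^sub>C prod_list (map (gen_value \<delta> \<rho>) w))"
  unfolding free_eval_def
  by (rule sum.mono_neutral_left) (use assms in \<open>auto simp: in_keys_iff\<close>)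

lemma free_eval_diff:
  fixes \<delta> \<rho> :: "'g \<Rightarrow> rat \<Rightarrow> 'a::unital_cstar_algebra"
  shows "free_eval \<delta> \<rho> (p - q) = free_eval \<delta> \<rho> p - free_eval \<delta> \<rho> q"
proof -
  let ?A = "Poly_Mapping.keys p \<union> Poly_Mapping.keys q"
  have diff: "(c - d) *\<^sub>C x = c *\<^sub>C x - d *\<^sub>C x" for c d and x :: 'a
    using scaleC_add_left[of "c - d" d x] by simp
  have "Poly_Mapping.keys (p - q) \<subseteq> ?A" by (auto simp: in_keys_iff lookup_minus)
  then show ?thesis
    by (simp add: free_eval_superset[of ?A] lookup_minus diff sum_subtractf)
qed

lemma free_eval_zero [simp]: "free_eval \<delta> \<rho> 0 = 0"
  by (simp add: free_eval_def)

lemma free_eval_add: "free_eval \<delta> \<rho> (p + q) = free_eval \<delta> \<rho> p + free_eval \<delta> \<rho> q"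
  using free_eval_diff[of \<delta> \<rho> "p + q" q] by simp

lemma free_eval_sum: "free_eval \<delta> \<rho> (sum f A) = (\<Sum>i\<in>A. free_eval \<delta> \<rho> (f i))"
  by (induction A rule: infinite_finite_induct) (simp_all add: free_eval_add)

lemma free_eval_word [simp]:
  "free_eval \<delta> \<rho> (Poly_Mapping.single w 1) = prod_list (map (gen_value \<delta> \<rho>) w)"
  by (simp add: free_eval_def)

lemma free_eval_one [simp]: "free_eval \<delta> \<rho> 1 = 1"
  by (metis free_eval_word list.simps(8) prod_list.Nil single_one zero_list_def)

text \<open>Relators multiply single letters only, so concatenation of words is the product rule by
  which they are evaluated.\<close>

lemma single_mult_word:
  "Poly_Mapping.single v 1 * Poly_Mapping.single w 1 = (Poly_Mapping.single (v @ w) 1 :: 'g free)"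
  by (simp add: mult_single plus_list_def)

lemma free_algebra_diff:
  "p \<in> free_algebra G H \<Longrightarrow> q \<in> free_algebra G H \<Longrightarrow> p - q \<in> free_algebra G H"
  using keys_diff[of p q] by (auto simp: free_algebra_def)

lemma free_algebra_add:
  "p \<in> free_algebra G H \<Longrightarrow> q \<in> free_algebra G H \<Longrightarrow> p + q \<in> free_algebra G H"
  using keys_add[of p q] by (auto simp: free_algebra_def)

lemma free_algebra_zero: "0 \<in> free_algebra G H"
  by (simp add: free_algebra_def)

lemma free_algebra_sum:
  "(\<And>i. i \<in> A \<Longrightarrow> f i \<in> free_algebra G H) \<Longrightarrow> sum f A \<in> free_algebra G H"
  by (induction A rule: infinite_finite_induct) (simp_all add: free_algebra_add free_algebra_zero)

lemma free_algebra_word: "set w \<subseteq> gens G H \<Longrightarrow> Poly_Mapping.single w 1 \<in> free_algebra G H"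
  by (auto simp: free_algebra_def)

lemma free_algebra_one: "1 \<in> free_algebra G H"
  by (simp add: free_algebra_def zero_list_def)

section \<open>Relations between \<delta> and \<rho> read off from the presentation\<close>

locale field_algebra = normal H G
  for H :: "'g set" and G :: "('g, 'm) monoid_scheme" (structure) +
  fixes \<delta> \<rho> :: "'g \<Rightarrow> rat \<Rightarrow> 'a::unital_cstar_algebra"
  assumes finite_carrier: "finite (carrier G)"
    and field_algebra: "is_field_algebra G H \<delta> \<rho>"
begin

text \<open>The kernel condition in \<open>is_field_algebra\<close> speaks only about elements of
  \<open>free_algebra G H\<close>. Normality of \<open>H\<close> enters here: the exchange relation
  conjugates one label by another.\<close>

lemma relators_free_algebra:
  assumes "r \<in> relators G H" shows "r \<in> free_algebra G H"
  using assms
  by induction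
    (auto simp: single_mult_word gens_def mem_carrier m_assoc[symmetric]
      intro!: free_algebra_diff free_algebra_sum free_algebra_word free_algebra_one
        free_algebra_zero inv_op_closed1)

text \<open>Relators lie in the ideal, which is the kernel of the evaluation. All relations that
  follow are instances.\<close>

lemma free_eval_relator: "r \<in> relators G H \<Longrightarrow> free_eval \<delta> \<rho> r = 0"
  using field_algebra relators_free_algebra by (auto simp: is_field_algebra_def intro: relation_ideal.intros)

lemma delta_sum: "x \<in> \<int> \<Longrightarrow> (\<Sum>g\<in>carrier G. \<delta> g x) = 1"
  using free_eval_relator[OF relators.delta_sum] by (simp add: free_eval_diff free_eval_sum)

lemma rho_one: "l \<in> links \<Longrightarrow> \<rho> \<one> l = 1"
  using free_eval_relator[OF relators.rho_unit] by (simp add: free_eval_diff)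

lemma delta_delta:
  "\<lbrakk>g \<in> carrier G; g' \<in> carrier G; x \<in> \<int>\<rbrakk> \<Longrightarrow> \<delta> g x * \<delta> g' x = (if g = g' then \<delta> g x else 0)"
  using free_eval_relator[OF relators.delta_orth]
  by (fastforce simp: free_eval_diff single_mult_word split: if_splits)

lemma rho_rho: "\<lbrakk>h \<in> H; h' \<in> H; l \<in> links\<rbrakk> \<Longrightarrow> \<rho> h l * \<rho> h' l = \<rho> (h \<otimes> h') l"
  using free_eval_relator[OF relators.rho_mult] by (simp add: free_eval_diff single_mult_word)

lemma delta_commute:
  "\<lbrakk>g \<in> carrier G; g' \<in> carrier G; x \<in> \<int>; x' \<in> \<int>\<rbrakk> \<Longrightarrow> \<delta> g x * \<delta> g' x' = \<delta> g' x' * \<delta> g x"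
  using free_eval_relator[OF relators.delta_commute] by (simp add: free_eval_diff single_mult_word)

lemma rho_delta_less:
  "\<lbrakk>h \<in> H; g \<in> carrier G; l \<in> links; x \<in> \<int>; l < x\<rbrakk> \<Longrightarrow> \<rho> h l * \<delta> g x = \<delta> (h \<otimes> g) x * \<rho> h l"
  using free_eval_relator[OF relators.rho_delta_less] by (simp add: free_eval_diff single_mult_word)

lemma rho_delta_greater:
  "\<lbrakk>h \<in> H; g \<in> carrier G; l \<in> links; x \<in> \<int>; x < l\<rbrakk> \<Longrightarrow> \<rho> h l * \<delta> g x = \<delta> g x * \<rho> h l"
  using free_eval_relator[OF relators.rho_delta_greater] by (simp add: free_eval_diff single_mult_word)

text \<open>The presentation covers \<open>l' < l\<close>. For equal links the formula is the group
  identity \<open>h h' = h' (inv h' h h')\<close>, so the weak inequality can be allowed.\<close>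

lemma rho_exchange:
  assumes "h \<in> H" "h' \<in> H" "l \<in> links" "l' \<in> links" "l' \<le> l"
  shows "\<rho> h l * \<rho> h' l' = \<rho> h' l' * \<rho> (inv h' \<otimes> h \<otimes> h') l"
proof (cases "l' = l")
  case True
  have "h' \<otimes> (inv h' \<otimes> h \<otimes> h') = h \<otimes> h'"
    using assms by (simp add: m_assoc[symmetric] mem_carrier)
  then show ?thesis using assms True by (simp add: rho_rho inv_op_closed1 mem_carrier)
next
  case False
  then show ?thesis
    using free_eval_relator[OF relators.rho_exchange[of h H h' l l']] assms
    by (simp add: free_eval_diff single_mult_word)
qed

text \<open>This is \<open>rho_exchange\<close> read from right to left, with the label
  \<open>q\<close> replaced by its conjugate under \<open>h\<close>.\<close>

lemma rho_exchange':
  assumes "h \<in> H" "q \<in> H" "l \<in> links" "l' \<in> links" "l \<le> l'"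
  shows "\<rho> h l * \<rho> q l' = \<rho> (h \<otimes> q \<otimes> inv h) l' * \<rho> h l"
proof -
  have "inv h \<otimes> (h \<otimes> q \<otimes> inv h) \<otimes> h = (inv h \<otimes> h) \<otimes> q \<otimes> (inv h \<otimes> h)"
    using assms by (simp only: m_assoc mem_carrier inv_closed m_closed)
  then have "inv h \<otimes> (h \<otimes> q \<otimes> inv h) \<otimes> h = q"
    using assms by (simp add: mem_carrier)
  then show ?thesis
    using rho_exchange[of "h \<otimes> q \<otimes> inv h" h l' l] assms by (simp add: inv_op_closed2 mem_carrier)
qed

lemma delta_adj: "g \<in> carrier G \<Longrightarrow> x \<in> \<int> \<Longrightarrow> (\<delta> g x)\<^sup>\<star> = \<delta> g x"
  using field_algebra by (simp add: is_field_algebra_def)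

lemma rho_adj: "h \<in> H \<Longrightarrow> l \<in> links \<Longrightarrow> (\<rho> h l)\<^sup>\<star> = \<rho> (inv h) l"
  using field_algebra by (simp add: is_field_algebra_def)

lemma field_local_dense: "closure (\<Union>n. field_local G H \<delta> \<rho> (interval n)) = UNIV"
  using field_algebra by (simp add: is_field_algebra_def)

lemma sum_shift_left:
  "k \<in> carrier G \<Longrightarrow> (\<Sum>f\<in>carrier G. \<phi> (k \<otimes> f)) = (\<Sum>f\<in>carrier G. \<phi> f)"
  by (rule sum.reindex_bij_witness[of _ "\<lambda>f. inv k \<otimes> f" "\<lambda>f. k \<otimes> f"])
    (auto simp: m_assoc[symmetric])

lemma sum_shift_right:
  "k \<in> carrier G \<Longrightarrow> (\<Sum>f\<in>carrier G. \<phi> (f \<otimes> k)) = (\<Sum>f\<in>carrier G. \<phi> f)"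
  by (rule sum.reindex_bij_witness[of _ "\<lambda>f. f \<otimes> inv k" "\<lambda>f. f \<otimes> k"])
    (auto simp: m_assoc)

end

section \<open>Commutation relations of the local observables\<close>

lemma link_left: "x \<in> \<int> \<Longrightarrow> x - 1/2 \<in> links" for x :: rat
  using Ints_diff[of x 1] by (simp add: links_def)

lemma link_right: "x \<in> \<int> \<Longrightarrow> x + 1/2 \<in> links" for x :: rat
  by (simp add: links_def)

lemma links_add_half: "l \<in> links \<Longrightarrow> l + 1/2 \<in> \<int>" for l :: rat
  using Ints_add[of "l - 1/2" 1] by (simp add: links_def add.commute)

lemma links_diff_half: "l \<in> links \<Longrightarrow> l - 1/2 \<in> \<int>" for l :: rat
  by (simp add: links_def)

lemmas link_simps = link_left link_right links_add_half links_diff_half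

text \<open>Integrality sharpens the strict inequality to the weak one accepted by
  \<open>rho_exchange'\<close>, which includes the link adjacent to \<open>x\<close>.\<close>

lemma links_less_site: "l \<in> links \<Longrightarrow> x \<in> \<int> \<Longrightarrow> l < x \<Longrightarrow> l \<le> x - 1/2" for l x :: rat
proof -
  assume l: "l \<in> links" and x: "x \<in> \<int>" "l < x"
  obtain m where m: "l - 1/2 = of_int m" using l by (auto simp: links_def Ints_def)
  obtain n where n: "x = of_int n" using x by (auto simp: Ints_def)
  have "of_int m + 1/2 < (of_int n :: rat)" using m n x by simp
  then have "(of_int m :: rat) < of_int n" by linarith
  then have "m < n" by simp
  then have "(of_int m :: rat) \<le> of_int n - 1" by (metis of_int_1 of_int_diff of_int_le_iff zle_diff1_eq)
  then show ?thesis using m n by linarith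
qed

lemma intertwine_mult:
  fixes r :: "'a::semigroup_mult"
  assumes "r * p = p' * r" and "r * q = q' * r"
  shows "r * (p * q) = p' * q' * r"
  by (metis assms mult.assoc)

context field_algebra
begin

abbreviation v where "v \<equiv> v_op G \<delta> \<rho>"
abbreviation w where "w \<equiv> w_op G \<delta>"

lemma inv_conj: "x \<in> carrier G \<Longrightarrow> y \<in> carrier G \<Longrightarrow> inv (x \<otimes> y \<otimes> inv x) = x \<otimes> inv y \<otimes> inv x"
  by (simp add: inv_mult_group m_assoc)

lemma cancel_left [simp]:
  "x \<in> carrier G \<Longrightarrow> y \<in> carrier G \<Longrightarrow> inv x \<otimes> (x \<otimes> y) = y"
  "x \<in> carrier G \<Longrightarrow> y \<in> carrier G \<Longrightarrow> x \<otimes> (inv x \<otimes> y) = y"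
  by (simp_all add: m_assoc[symmetric])

lemma delta_rho_less:
  assumes "h \<in> H" "g \<in> carrier G" "l \<in> links" "x \<in> \<int>" "l < x"
  shows "\<delta> g x * \<rho> h l = \<rho> h l * \<delta> (inv h \<otimes> g) x"
  using rho_delta_less[of h "inv h \<otimes> g" l x] assms by (simp add: mem_carrier)

section \<open>Adjoints of \<open>v\<close> and \<open>w\<close>\<close>

lemma w_adj:
  assumes "g \<in> carrier G" "l \<in> links"
  shows "(w g l)\<^sup>\<star> = w g l"
  unfolding w_op_def adj_sum
  by (rule sum.cong) (use assms in \<open>auto simp: adj_mult delta_adj link_simps delta_commute\<close>)

text \<open>The adjoint of the \<open>f\<close>-term of \<open>v h x\<close> is the term of
  \<open>v (inv h) x\<close> with index \<open>f \<otimes> inv h\<close>; right translation then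
  reindexes the sum.\<close>

lemma v_adj:
  assumes h: "h \<in> H" and x: "x \<in> \<int>"
  shows "(v h x)\<^sup>\<star> = v (inv h) x"
proof -
  have hc: "h \<in> carrier G" using h mem_carrier by blast
  let ?t = "\<lambda>h f. \<rho> (f \<otimes> inv h \<otimes> inv f) (x - 1/2) * \<delta> f x * \<rho> (f \<otimes> h \<otimes> inv f) (x + 1/2)"
  have "(?t h f)\<^sup>\<star> = ?t (inv h) (f \<otimes> inv h)" if f: "f \<in> carrier G" for f
  proof -
    define p where "p = f \<otimes> h \<otimes> inv f"
    have p: "p \<in> H" "inv p \<in> H" "inv p = f \<otimes> inv h \<otimes> inv f" "p \<in> carrier G"
      using h f hc by (auto simp: p_def inv_op_closed2 inv_conj mem_carrier)
    have e: "f \<otimes> inv h = inv p \<otimes> f" "f \<otimes> inv h \<otimes> h \<otimes> inv (f \<otimes> inv h) = p"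
      "f \<otimes> inv h \<otimes> inv h \<otimes> inv (f \<otimes> inv h) = inv p"
      using f hc by (simp_all add: p(3)) (simp_all add: p_def m_assoc inv_mult_group)
    have "?t h f = \<rho> (inv p) (x - 1/2) * \<delta> f x * \<rho> p (x + 1/2)"
      unfolding p(3) unfolding p_def by (rule refl)
    then have "(?t h f)\<^sup>\<star> = \<rho> (inv p) (x + 1/2) * (\<delta> f x * \<rho> p (x - 1/2))"
      using f p(1,2,4) x by (simp add: adj_mult rho_adj delta_adj link_simps)
    also have "\<dots> = (\<rho> (inv p) (x + 1/2) * \<rho> p (x - 1/2)) * \<delta> (inv p \<otimes> f) x"
      using f p x by (simp add: delta_rho_less link_simps mult.assoc)
    \<comment> \<open>Exchanging the links conjugates \<open>inv p\<close> by \<open>p\<close>,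
      which leaves it unchanged.\<close>
    also have "\<rho> (inv p) (x + 1/2) * \<rho> p (x - 1/2) = \<rho> p (x - 1/2) * \<rho> (inv p) (x + 1/2)"
      using rho_exchange[of "inv p" p "x + 1/2" "x - 1/2"] p(1,2,4) x
      by (simp add: m_assoc link_simps)
    also have "\<rho> p (x - 1/2) * \<rho> (inv p) (x + 1/2) * \<delta> (inv p \<otimes> f) x
        = \<rho> p (x - 1/2) * \<delta> (inv p \<otimes> f) x * \<rho> (inv p) (x + 1/2)"
      using p x f by (simp add: mult.assoc rho_delta_greater link_simps)
    also have "\<dots> = ?t (inv h) (f \<otimes> inv h)"
      unfolding inv_inv[OF hc] e(2,3) unfolding e(1) by (rule refl)
    finally show ?thesis .
  qed
  then have "(v h x)\<^sup>\<star> = (\<Sum>f\<in>carrier G. ?t (inv h) (f \<otimes> inv h))"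
    unfolding v_op_def adj_sum by (intro sum.cong) auto
  also have "\<dots> = v (inv h) x"
    unfolding v_op_def by (rule sum_shift_right) (use hc in simp)
  finally show ?thesis .
qed

section \<open>Commutation of \<open>v\<close> and \<open>w\<close> with \<delta> and \<rho>\<close>

text \<open>Integrality gives \<open>y < x - 1/2\<close>, so both links occurring in
  \<open>v k x\<close> lie to the right of \<open>y\<close> and commute with \<delta> there.\<close>

lemma delta_v_less:
  assumes "k \<in> H" "x \<in> \<int>" "f \<in> carrier G" "y \<in> \<int>" "y < x"
  shows "v k x * \<delta> f y = \<delta> f y * v k x"
  unfolding v_op_def sum_distrib_left sum_distrib_right
proof (rule sum.cong)
  fix g assume g: "g \<in> carrier G"
  let ?p = "g \<otimes> k \<otimes> inv g" and ?q = "g \<otimes> inv k \<otimes> inv g"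
  have pq: "?p \<in> H" "?q \<in> H" using assms g by (auto simp: inv_op_closed2)
  have "y + 1 \<le> x"
    using assms by (auto simp: Ints_def)
  then have "y < x - 1/2" by linarith
  then have 1: "\<delta> f y * \<rho> ?q (x - 1/2) = \<rho> ?q (x - 1/2) * \<delta> f y"
    and 2: "\<delta> f y * \<delta> g x = \<delta> g x * \<delta> f y"
    and 3: "\<delta> f y * \<rho> ?p (x + 1/2) = \<rho> ?p (x + 1/2) * \<delta> f y"
    using assms g pq by (simp_all add: rho_delta_greater link_simps delta_commute)
  show "\<rho> ?q (x - 1/2) * \<delta> g x * \<rho> ?p (x + 1/2) * \<delta> f y
      = \<delta> f y * (\<rho> ?q (x - 1/2) * \<delta> g x * \<rho> ?p (x + 1/2))"
    by (intro intertwine_mult[symmetric] intertwine_mult 1 2 3)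
qed simp

text \<open>\<delta> at \<open>x\<close> commutes with \<rho> at the link to its right, so
  orthogonality at \<open>x\<close> leaves only the term with index \<open>f\<close>.\<close>

lemma v_delta:
  assumes k: "k \<in> H" and x: "x \<in> \<int>" and f: "f \<in> carrier G"
  shows "v k x * \<delta> f x = \<rho> (f \<otimes> inv k \<otimes> inv f) (x - 1/2) * \<delta> f x * \<rho> (f \<otimes> k \<otimes> inv f) (x + 1/2)"
proof -
  let ?t = "\<lambda>f. \<rho> (f \<otimes> inv k \<otimes> inv f) (x - 1/2) * \<delta> f x * \<rho> (f \<otimes> k \<otimes> inv f) (x + 1/2)"
  have "?t g * \<delta> f x = (if g = f then ?t f else 0)" if g: "g \<in> carrier G" for g
  proof -
    have "g \<otimes> k \<otimes> inv g \<in> H" using k g by (simp add: inv_op_closed2)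
    then have "?t g * \<delta> f x
        = \<rho> (g \<otimes> inv k \<otimes> inv g) (x - 1/2) * (\<delta> g x * \<delta> f x) * \<rho> (g \<otimes> k \<otimes> inv g) (x + 1/2)"
      using f x by (simp add: mult.assoc rho_delta_greater link_simps)
    then show ?thesis using f g x by (simp add: delta_delta)
  qed
  then have "v k x * \<delta> f x = (\<Sum>g\<in>carrier G. if g = f then ?t f else 0)"
    unfolding v_op_def sum_distrib_right by (intro sum.cong) auto
  then show ?thesis using f finite_carrier by (simp add: sum.delta)
qed

text \<open>From the left the surviving term has index \<open>f \<otimes> k\<close>, because
  \<delta> with label \<open>g\<close> becomes \<delta> with label \<open>g \<otimes> inv k\<close>
  when moved across the left link. Conjugating \<open>k\<close> by \<open>f \<otimes> k\<close> or
  by \<open>f\<close> gives the same element.\<close>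

lemma delta_v:
  assumes k: "k \<in> H" and x: "x \<in> \<int>" and f: "f \<in> carrier G"
  shows "\<delta> f x * v k x
    = \<delta> f x * (\<rho> (f \<otimes> inv k \<otimes> inv f) (x - 1/2) * \<rho> (f \<otimes> k \<otimes> inv f) (x + 1/2))"
proof -
  have kc: "k \<in> carrier G" using k mem_carrier by blast
  let ?t = "\<lambda>f. \<rho> (f \<otimes> inv k \<otimes> inv f) (x - 1/2) * \<delta> f x * \<rho> (f \<otimes> k \<otimes> inv f) (x + 1/2)"
  have "\<delta> f x * ?t g = (if g = f \<otimes> k then \<delta> f x * (\<rho> (f \<otimes> inv k \<otimes> inv f) (x - 1/2)
      * \<rho> (f \<otimes> k \<otimes> inv f) (x + 1/2)) else 0)" if g: "g \<in> carrier G" for g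
  proof -
    have "g \<otimes> inv k \<otimes> inv g \<in> H" using k g by (simp add: inv_op_closed2)
    then have "\<rho> (g \<otimes> inv k \<otimes> inv g) (x - 1/2) * \<delta> g x
        = \<delta> (g \<otimes> inv k) x * \<rho> (g \<otimes> inv k \<otimes> inv g) (x - 1/2)"
      using g x kc by (simp add: rho_delta_less link_simps m_assoc)
    then have "\<delta> f x * ?t g = (\<delta> f x * \<delta> (g \<otimes> inv k) x)
        * (\<rho> (g \<otimes> inv k \<otimes> inv g) (x - 1/2) * \<rho> (g \<otimes> k \<otimes> inv g) (x + 1/2))"
      by (simp add: mult.assoc)
    moreover have "f = g \<otimes> inv k \<longleftrightarrow> g = f \<otimes> k"
      using f g kc by (auto simp: m_assoc)
    ultimately show ?thesis
      using f g kc x by (auto simp: delta_delta m_assoc inv_mult_group)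
  qed
  then have "\<delta> f x * v k x = (\<Sum>g\<in>carrier G. if g = f \<otimes> k then \<delta> f x * (\<rho> (f \<otimes> inv k \<otimes> inv f) (x - 1/2)
      * \<rho> (f \<otimes> k \<otimes> inv f) (x + 1/2)) else 0)"
    unfolding v_op_def sum_distrib_left by (intro sum.cong) auto
  then show ?thesis using f kc finite_carrier by (simp add: sum.delta)
qed

text \<open>\<open>v_delta\<close> at \<open>f\<close> and \<open>delta_v\<close> at
  \<open>f \<otimes> inv k\<close> reduce both sides to the same term. On the labels at
  \<open>x\<close>, \<open>v k x\<close> acts by right translation.\<close>

lemma v_delta_shift:
  assumes k: "k \<in> H" and x: "x \<in> \<int>" and f: "f \<in> carrier G"
  shows "v k x * \<delta> f x = \<delta> (f \<otimes> inv k) x * v k x"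
proof -
  have kc: "k \<in> carrier G" using k mem_carrier by blast
  have "f \<otimes> inv k \<otimes> inv f \<in> H" using k f by (simp add: inv_op_closed2)
  then have "v k x * \<delta> f x = \<delta> (f \<otimes> inv k) x * (\<rho> (f \<otimes> inv k \<otimes> inv f) (x - 1/2)
      * \<rho> (f \<otimes> k \<otimes> inv f) (x + 1/2))"
    using k x f kc by (simp add: v_delta rho_delta_less link_simps m_assoc mult.assoc)
  also have "\<dots> = \<delta> (f \<otimes> inv k) x * v k x"
    using k x f kc by (simp add: delta_v m_assoc inv_mult_group)
  finally show ?thesis .
qed

text \<open>Moving \<rho> through sends the \<open>f\<close>-term to the term with index
  \<open>h \<otimes> f\<close>, and the sum is invariant under this translation.\<close>

lemma rho_v:
  assumes h: "h \<in> H" and k: "k \<in> H" and x: "x \<in> \<int>" and l: "l \<in> links" "l < x"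
  shows "\<rho> h l * v k x = v k x * \<rho> h l"
proof -
  have hk: "h \<in> carrier G" "k \<in> carrier G" using h k by (auto intro: mem_carrier)
  let ?t = "\<lambda>f. \<rho> (f \<otimes> inv k \<otimes> inv f) (x - 1/2) * \<delta> f x * \<rho> (f \<otimes> k \<otimes> inv f) (x + 1/2)"
  have le: "l \<le> x - 1/2" using links_less_site l x by blast
  then have le': "l \<le> x + 1/2" by linarith
  have "\<rho> h l * ?t f = ?t (h \<otimes> f) * \<rho> h l" if f: "f \<in> carrier G" for f
  proof -
    let ?p = "f \<otimes> k \<otimes> inv f" and ?q = "f \<otimes> inv k \<otimes> inv f"
    have pq: "?p \<in> H" "?q \<in> H" using k f by (auto simp: inv_op_closed2)
    have e: "h \<otimes> f \<otimes> inv k \<otimes> inv (h \<otimes> f) = h \<otimes> ?q \<otimes> inv h"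
      "h \<otimes> f \<otimes> k \<otimes> inv (h \<otimes> f) = h \<otimes> ?p \<otimes> inv h"
      using f hk by (simp_all add: m_assoc inv_mult_group)
    have 1: "\<rho> h l * \<rho> ?q (x - 1/2) = \<rho> (h \<otimes> ?q \<otimes> inv h) (x - 1/2) * \<rho> h l"
      using h pq l le x by (intro rho_exchange') (simp_all add: link_simps)
    have 2: "\<rho> h l * \<delta> f x = \<delta> (h \<otimes> f) x * \<rho> h l"
      using h f l x by (simp add: rho_delta_less)
    have 3: "\<rho> h l * \<rho> ?p (x + 1/2) = \<rho> (h \<otimes> ?p \<otimes> inv h) (x + 1/2) * \<rho> h l"
      using h pq l le' x by (intro rho_exchange') (simp_all add: link_simps)
    show ?thesis unfolding e by (intro intertwine_mult 1 2 3)
  qed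
  then have "\<rho> h l * v k x = (\<Sum>f\<in>carrier G. ?t (h \<otimes> f)) * \<rho> h l"
    unfolding v_op_def sum_distrib_left sum_distrib_right by (intro sum.cong) auto
  also have "(\<Sum>f\<in>carrier G. ?t (h \<otimes> f)) = v k x"
    unfolding v_op_def by (rule sum_shift_left) (use hk in simp)
  finally show ?thesis .
qed

lemma delta_w:
  assumes "f \<in> carrier G" "y \<in> \<int>" "g \<in> carrier G" "l \<in> links"
  shows "w g l * \<delta> f y = \<delta> f y * w g l"
  unfolding w_op_def sum_distrib_left sum_distrib_right
proof (rule sum.cong)
  fix k assume "k \<in> carrier G"
  with assms have "\<delta> f y * \<delta> k (l - 1/2) = \<delta> k (l - 1/2) * \<delta> f y"
    and "\<delta> f y * \<delta> (k \<otimes> g) (l + 1/2) = \<delta> (k \<otimes> g) (l + 1/2) * \<delta> f y"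
    by (simp_all add: delta_commute link_simps)
  then show "\<delta> k (l - 1/2) * \<delta> (k \<otimes> g) (l + 1/2) * \<delta> f y
      = \<delta> f y * (\<delta> k (l - 1/2) * \<delta> (k \<otimes> g) (l + 1/2))"
    by (rule intertwine_mult[symmetric])
qed simp

text \<open>Both sites of \<open>w g l\<close> lie to the right of \<open>l'\<close>, so both labels
  are multiplied by \<open>h\<close> from the left. This preserves their quotient \<open>g\<close>
  and merely permutes the terms.\<close>

lemma rho_w:
  assumes h: "h \<in> H" and g: "g \<in> carrier G" and l: "l \<in> links" "l' \<in> links" "l' < l - 1/2"
  shows "\<rho> h l' * w g l = w g l * \<rho> h l'"
proof -
  have hc: "h \<in> carrier G" using h mem_carrier by blast
  let ?t = "\<lambda>f. \<delta> f (l - 1/2) * \<delta> (f \<otimes> g) (l + 1/2)"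
  have "\<rho> h l' * ?t f = ?t (h \<otimes> f) * \<rho> h l'" if f: "f \<in> carrier G" for f
  proof -
    have "\<rho> h l' * \<delta> f (l - 1/2) = \<delta> (h \<otimes> f) (l - 1/2) * \<rho> h l'"
      and "\<rho> h l' * \<delta> (f \<otimes> g) (l + 1/2) = \<delta> (h \<otimes> f \<otimes> g) (l + 1/2) * \<rho> h l'"
      using h hc f g l by (simp_all add: rho_delta_less link_simps m_assoc)
    then show ?thesis by (rule intertwine_mult)
  qed
  then have "\<rho> h l' * w g l = (\<Sum>f\<in>carrier G. ?t (h \<otimes> f)) * \<rho> h l'"
    unfolding w_op_def sum_distrib_left sum_distrib_right by (intro sum.cong) auto
  also have "(\<Sum>f\<in>carrier G. ?t (h \<otimes> f)) = w g l"
    unfolding w_op_def by (rule sum_shift_left) (use hc in simp)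
  finally show ?thesis .
qed

section \<open>Expressing fields through those one step further left\<close>

text \<open>Once \<delta> fixes the label at \<open>x\<close> to be \<open>f\<close>, the relative
  label \<open>inv f \<otimes> g\<close> fixes the label at \<open>x + 1\<close> to be
  \<open>g\<close>. Summing over \<open>f\<close> removes the condition at \<open>x\<close>.\<close>

lemma delta_propagate:
  assumes g: "g \<in> carrier G" and x: "x \<in> \<int>"
  shows "\<delta> g (x + 1) = (\<Sum>f\<in>carrier G. \<delta> f x * w (inv f \<otimes> g) (x + 1/2))"
proof -
  have "\<delta> f x * w (inv f \<otimes> g) (x + 1/2) = \<delta> f x * \<delta> g (x + 1)" if f: "f \<in> carrier G" for f
  proof -
    have "\<delta> f x * w (inv f \<otimes> g) (x + 1/2)
        = (\<Sum>k\<in>carrier G. (\<delta> f x * \<delta> k x) * \<delta> (k \<otimes> (inv f \<otimes> g)) (x + 1))"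
      unfolding w_op_def sum_distrib_left by (simp add: mult.assoc add.commute)
    also have "\<dots> = (\<Sum>k\<in>carrier G. if k = f then \<delta> f x * \<delta> g (x + 1) else 0)"
      using f g x by (intro sum.cong) (auto simp: delta_delta)
    finally show ?thesis using f finite_carrier by (simp add: sum.delta)
  qed
  then have "(\<Sum>f\<in>carrier G. \<delta> f x * w (inv f \<otimes> g) (x + 1/2)) = (\<Sum>f\<in>carrier G. \<delta> f x) * \<delta> g (x + 1)"
    unfolding sum_distrib_right by (intro sum.cong) auto
  then show ?thesis using x by (simp add: delta_sum)
qed

text \<open>By \<open>delta_v\<close>, the choice \<open>inv f \<otimes> k \<otimes> f\<close> makes
  both link labels independent of \<open>f\<close>, so the deltas sum to 1. What remains is \<rho>
  with label \<open>inv k\<close> at the left link times \<rho> with label \<open>k\<close> at the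
  right link.\<close>

lemma rho_propagate:
  assumes k: "k \<in> H" and x: "x \<in> \<int>"
  shows "\<rho> k (x + 1/2) = \<rho> k (x - 1/2) * (\<Sum>f\<in>carrier G. \<delta> f x * v (inv f \<otimes> k \<otimes> f) x)"
proof -
  have kc: "k \<in> carrier G" "inv k \<in> H" using k mem_carrier by auto
  have "\<delta> f x * v (inv f \<otimes> k \<otimes> f) x = \<delta> f x * (\<rho> (inv k) (x - 1/2) * \<rho> k (x + 1/2))"
    if f: "f \<in> carrier G" for f
    using delta_v[OF inv_op_closed1[OF f k] x f] f kc
    by (simp add: m_assoc inv_mult_group)
  then have "(\<Sum>f\<in>carrier G. \<delta> f x * v (inv f \<otimes> k \<otimes> f) x)
      = (\<Sum>f\<in>carrier G. \<delta> f x) * (\<rho> (inv k) (x - 1/2) * \<rho> k (x + 1/2))"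
    unfolding sum_distrib_right by (intro sum.cong) auto
  also have "\<dots> = \<rho> (inv k) (x - 1/2) * \<rho> k (x + 1/2)" using x by (simp add: delta_sum)
  finally have "\<rho> k (x - 1/2) * (\<Sum>f\<in>carrier G. \<delta> f x * v (inv f \<otimes> k \<otimes> f) x)
      = \<rho> k (x - 1/2) * \<rho> (inv k) (x - 1/2) * \<rho> k (x + 1/2)"
    by (simp add: mult.assoc)
  then show ?thesis using k kc x by (simp add: rho_rho rho_one link_simps)
qed

end

section \<open>Local algebras\<close>

lemma Ints_half_lattice: "x \<in> \<int> \<Longrightarrow> x \<in> half_lattice"
  by (simp add: half_lattice_def)

lemma links_half_lattice: "l \<in> links \<Longrightarrow> l \<in> half_lattice"
proof -
  assume "l \<in> links"
  then have "2 * (l - 1/2) + 1 \<in> \<int>" unfolding links_def by (intro Ints_add Ints_mult) auto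
  then show ?thesis by (simp add: half_lattice_def algebra_simps)
qed

lemma links_not_Ints: "l \<in> links \<Longrightarrow> l \<notin> \<int>" for l :: rat
proof
  assume "l \<in> links" "l \<in> \<int>"
  then obtain m n where "l - 1/2 = of_int m" "l = of_int n" by (auto simp: links_def Ints_def)
  then have "of_int (2 * n - 2 * m) = (of_int 1 :: rat)" by simp
  then show False unfolding of_int_eq_iff by presburger
qed

lemma finite_regions_Un: "L \<in> finite_regions \<Longrightarrow> M \<in> finite_regions \<Longrightarrow> L \<union> M \<in> finite_regions"
  by (simp add: finite_regions_def)

lemma finite_regions_nonempty: "finite_regions \<noteq> {}"
  by (auto simp: finite_regions_def)

context field_algebra
begin

lemma finite_H: "finite H"
  using finite_carrier finite_subset subset by blast

lemma H_one: "\<one> \<in> H" by simp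

abbreviation delta_gens :: "rat set \<Rightarrow> 'a set" where
  "delta_gens E \<equiv> {\<delta> g x | g x. g \<in> carrier G \<and> x \<in> E}"

abbreviation rho_gens :: "rat set \<Rightarrow> 'a set" where
  "rho_gens L \<equiv> {\<rho> h l | h l. h \<in> H \<and> l \<in> L}"

section \<open>Finite dimension of the local field algebras\<close>

lemma finite_dim_deltas:
  assumes "finite E" and "E \<subseteq> \<int>"
  shows "\<exists>T. finite T \<and> unital_subalgebra hull (delta_gens E) \<subseteq> span T"
  using assms
proof (induction E)
  case empty
  \<comment> \<open>Without sites the algebra consists of the scalars, whose real dimension is at
    most two; \<open>span\<close> is the real span.\<close>
  have decomp: "c *\<^sub>C (1::'a) = Re c *\<^sub>R 1 + Im c *\<^sub>R \<i> *\<^sub>C 1" for c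
    unfolding scaleR_scaleC scaleC_scaleC scaleC_add_left[symmetric]
    by (metis complex_eq mult.commute)
  have "c *\<^sub>C (1::'a) \<in> span {1, \<i> *\<^sub>C 1}" for c
    by (subst decomp) (intro span_add span_scale span_base, auto)
  moreover have "unital_subalgebra (range (\<lambda>c. c *\<^sub>C (1::'a)))"
    unfolding unital_subalgebra_def
    by (auto simp: scaleC_scaleC scaleC_add_left[symmetric] mult_scaleC_left
      intro: range_eqI[of _ _ 1])
  then have "unital_subalgebra hull {} \<subseteq> range (\<lambda>c. c *\<^sub>C (1::'a))"
    by (intro hull_minimal) auto
  ultimately have "unital_subalgebra hull {} \<subseteq> span {1, \<i> *\<^sub>C 1 :: 'a}" by blast
  then show ?case by (intro exI[of _ "{1, \<i> *\<^sub>C 1}"]) simp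
next
  case (insert y E)
  then obtain T where T: "finite T" "unital_subalgebra hull (delta_gens E) \<subseteq> span T" by auto
  have y: "y \<in> \<int>" using insert by simp
  let ?S = "(\<lambda>g. \<delta> g y) ` carrier G"
  have "\<exists>T'. finite T' \<and> unital_subalgebra hull (delta_gens E \<union> ?S) \<subseteq> span T'"
  proof (rule finite_dim_extend[OF T])
    show "finite ?S" using finite_carrier by simp
    show "1 \<in> span ?S"
      unfolding delta_sum[OF y, symmetric] by (intro span_sum span_base) auto
    show "s * s' \<in> span ?S" if "s \<in> ?S" "s' \<in> ?S" for s s'
      using that y by (auto simp: delta_delta span_zero span_base)
    show "\<exists>x'\<in>delta_gens E. \<exists>s'\<in>?S. s * x = x' * s'" if sx: "s \<in> ?S" "x \<in> delta_gens E" for s x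
    proof (intro bexI)
      show "s * x = x * s" using sx insert.prems by (auto intro: delta_commute)
    qed (use sx in auto)
  qed
  moreover have "delta_gens E \<union> ?S = delta_gens (insert y E)" by auto
  ultimately show ?case by simp
qed

text \<open>Links are adjoined from left to right, after all sites: \<open>rho_exchange\<close>
  moves \<rho> at the larger link to the right past the smaller links and changes only its own
  label, as \<open>finite_dim_extend\<close> requires.\<close>

lemma finite_dim_gens:
  assumes "finite L" and "L \<subseteq> links" and E: "finite E" "E \<subseteq> \<int>"
  shows "\<exists>T. finite T \<and> unital_subalgebra hull (delta_gens E \<union> rho_gens L) \<subseteq> span T"
  using assms(1,2)
proof (induction L rule: finite_linorder_max_induct)
  case empty
  then show ?case using finite_dim_deltas[OF E] by simp
next
  case (insert l L)
  then obtain T where T: "finite T" "unital_subalgebra hull (delta_gens E \<union> rho_gens L) \<subseteq> span T"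
    by auto
  have l: "l \<in> links" using insert by simp
  let ?X = "delta_gens E \<union> rho_gens L"
  let ?S = "(\<lambda>h. \<rho> h l) ` H"
  have "\<exists>T'. finite T' \<and> unital_subalgebra hull (?X \<union> ?S) \<subseteq> span T'"
  proof (rule finite_dim_extend[OF T])
    show "finite ?S" using finite_H by simp
    show "1 \<in> span ?S"
      unfolding rho_one[OF l, symmetric] by (intro span_base) auto
    show "s * s' \<in> span ?S" if "s \<in> ?S" "s' \<in> ?S" for s s'
      using that l by (auto simp: rho_rho intro!: span_base)
    show "\<exists>x'\<in>?X. \<exists>s'\<in>?S. s * x = x' * s'" if sx: "s \<in> ?S" "x \<in> ?X" for s x
    proof -
      obtain h where h: "s = \<rho> h l" "h \<in> H" using sx by auto
      consider (delta) g y where "x = \<delta> g y" "g \<in> carrier G" "y \<in> E"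
        | (rho) k l' where "x = \<rho> k l'" "k \<in> H" "l' \<in> L" using sx by blast
      then show ?thesis
      proof cases
        case delta
        have y: "y \<in> \<int>" using delta E by blast
        then have "l \<noteq> y" using links_not_Ints[OF l] by blast
        then consider "l < y" | "y < l" by linarith
        then show ?thesis
        proof cases
          case 1
          then have "s * x = \<delta> (h \<otimes> g) y * s" using delta h l y by (simp add: rho_delta_less)
          moreover have "\<delta> (h \<otimes> g) y \<in> ?X"
            using delta h by (intro UnI1 CollectI exI[of _ "h \<otimes> g"] exI[of _ y]) (simp add: mem_carrier)
          ultimately show ?thesis using sx(1) by blast
        next
          case 2
          then have "s * x = x * s" using delta h l y by (simp add: rho_delta_greater)
          then show ?thesis using sx by blast
        qed
      next
        case rho
        then have l': "l' \<in> links" "l' \<le> l" using insert by (auto intro: less_imp_le)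
        then have "s * x = x * \<rho> (inv k \<otimes> h \<otimes> k) l" using rho h l by (simp add: rho_exchange)
        moreover have "\<rho> (inv k \<otimes> h \<otimes> k) l \<in> ?S" using rho h by (simp add: inv_op_closed1 mem_carrier)
        ultimately show ?thesis using sx(2) by blast
      qed
    qed
  qed
  moreover have "?X \<union> ?S = delta_gens E \<union> rho_gens (insert l L)" by auto
  ultimately show ?case by simp
qed

section \<open>Algebras of local observables\<close>

abbreviation local_observables :: "rat set \<Rightarrow> 'a set" where
  "local_observables \<equiv> observable_local G H \<delta> \<rho>"

lemma unital_subalgebra_local: "unital_subalgebra (local_observables \<Lambda>)"
  by (simp add: observable_local_def unital_subalgebra_hull)

lemma v_local: "h \<in> H \<Longrightarrow> x \<in> \<Lambda> \<Longrightarrow> x \<in> \<int> \<Longrightarrow> v h x \<in> local_observables \<Lambda>"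
  unfolding observable_local_def by (rule hull_inc) blast

lemma w_local: "g \<in> carrier G \<Longrightarrow> l \<in> \<Lambda> \<Longrightarrow> l \<in> links \<Longrightarrow> w g l \<in> local_observables \<Lambda>"
  unfolding observable_local_def by (rule hull_inc) blast

lemma local_mono: "L \<subseteq> M \<Longrightarrow> local_observables L \<subseteq> local_observables M"
  unfolding observable_local_def by (rule hull_mono) blast

lemma local_adj:
  assumes "y \<in> local_observables \<Lambda>" shows "y\<^sup>\<star> \<in> local_observables \<Lambda>"
  using assms unfolding observable_local_def
proof (rule adj_mem_hull[rotated])
  fix y assume "y \<in> {v h x | h x. h \<in> H \<and> x \<in> \<Lambda> \<inter> \<int>} \<union> {w g l | g l. g \<in> carrier G \<and> l \<in> \<Lambda> \<inter> links}"
  then show "y\<^sup>\<star> \<in> {v h x | h x. h \<in> H \<and> x \<in> \<Lambda> \<inter> \<int>} \<union> {w g l | g l. g \<in> carrier G \<and> l \<in> \<Lambda> \<inter> links}"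
  proof (elim UnE CollectE exE conjE)
    fix h x assume "y = v h x" "h \<in> H" "x \<in> \<Lambda> \<inter> \<int>"
    then show ?thesis by (intro UnI1) (auto simp: v_adj intro!: exI[of _ "inv h"])
  next
    fix g l assume "y = w g l" "g \<in> carrier G" "l \<in> \<Lambda> \<inter> links"
    then show ?thesis by (intro UnI2) (auto simp: w_adj)
  qed
qed

text \<open>The algebra embeds in a finite-dimensional algebra of fields on a slightly larger
  region.\<close>

lemma closed_local:
  assumes "\<Lambda> \<in> finite_regions" shows "closed (local_observables \<Lambda>)"
proof -
  \<comment> \<open>\<open>v\<close> at a site uses the two adjacent links and \<open>w\<close> at a
    link the two adjacent sites, so the region grows by half a step on both sides.\<close>
  let ?N = "\<Lambda> \<union> (\<lambda>s. s + 1/2) ` \<Lambda> \<union> (\<lambda>s. s - 1/2) ` \<Lambda>"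
  have "finite ?N" using assms by (simp add: finite_regions_def)
  then obtain T where T: "finite T"
      "unital_subalgebra hull (delta_gens (?N \<inter> \<int>) \<union> rho_gens (?N \<inter> links)) \<subseteq> span T"
    using finite_dim_gens[of "?N \<inter> links" "?N \<inter> \<int>"] by auto
  let ?F = "unital_subalgebra hull (delta_gens (?N \<inter> \<int>) \<union> rho_gens (?N \<inter> links))"
  note F = unital_subalgebra_hull[of "delta_gens (?N \<inter> \<int>) \<union> rho_gens (?N \<inter> links)"]
  have d: "\<delta> g x \<in> ?F" if "g \<in> carrier G" "x \<in> \<int>" "x \<in> ?N" for g x
    using that by (intro hull_inc) blast
  have r: "\<rho> h l \<in> ?F" if "h \<in> H" "l \<in> links" "l \<in> ?N" for h l
    using that by (intro hull_inc) blast
  have "local_observables \<Lambda> \<subseteq> ?F"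
    unfolding observable_local_def
  proof (rule hull_minimal[where S = unital_subalgebra, OF _ F], safe)
    fix h x assume "h \<in> H" "x \<in> \<Lambda>" "x \<in> (\<int>::rat set)"
    then show "v h x \<in> ?F"
      unfolding v_op_def
      by (intro unital_subalgebra_sum[OF F] unital_subalgebraD(3)[OF F] d r)
        (auto simp: link_simps inv_op_closed2)
  next
    fix g l assume "g \<in> carrier G" "l \<in> \<Lambda>" "l \<in> links"
    then show "w g l \<in> ?F"
      unfolding w_op_def
      by (intro unital_subalgebra_sum[OF F] unital_subalgebraD(3)[OF F] d)
        (auto simp: link_simps)
  qed
  then show ?thesis
    using closed_subspace_finite_dim[OF unital_subalgebra_subspace[OF unital_subalgebra_local] T(1)] T(2)
    by blast
qed

lemma directed_system: "cstar_directed_system finite_regions local_observables"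
  unfolding cstar_directed_system_def cstar_subalgebra_def
  using finite_regions_nonempty finite_regions_Un unital_subalgebra_local local_adj closed_local local_mono
  by (metis Un_upper1 Un_upper2)

text \<open>This is the algebraic union, before the closure is taken.\<close>

definition quasilocal :: "'a set" where
  "quasilocal = (\<Union>\<Lambda>\<in>finite_regions. local_observables \<Lambda>)"

text \<open>Two elements always lie in the algebra of the union of their regions.\<close>

lemma unital_subalgebra_quasilocal: "unital_subalgebra quasilocal"
proof -
  have *: "\<exists>\<Lambda>\<in>finite_regions. x \<in> local_observables \<Lambda> \<and> y \<in> local_observables \<Lambda>"
    if xy: "x \<in> quasilocal" "y \<in> quasilocal" for x y
  proof -
    obtain L M where LM: "L \<in> finite_regions" "M \<in> finite_regions"
      "x \<in> local_observables L" "y \<in> local_observables M"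
      using xy by (auto simp: quasilocal_def)
    then show ?thesis
      using local_mono[of L "L \<union> M"] local_mono[of M "L \<union> M"]
      by (intro bexI[of _ "L \<union> M"]) (auto simp: finite_regions_Un)
  qed
  show ?thesis
    unfolding unital_subalgebra_def
  proof (intro conjI ballI allI)
    show "1 \<in> quasilocal"
      using finite_regions_nonempty unital_subalgebraD(1)[OF unital_subalgebra_local]
      by (auto simp: quasilocal_def)
    show "x + y \<in> quasilocal" "x * y \<in> quasilocal" if xy: "x \<in> quasilocal" "y \<in> quasilocal" for x y
      using *[OF xy] unital_subalgebraD(2,3)[OF unital_subalgebra_local]
      unfolding quasilocal_def by (meson UN_I)+
    show "c *\<^sub>C x \<in> quasilocal" if "x \<in> quasilocal" for x c
      using that unital_subalgebraD(4)[OF unital_subalgebra_local] by (auto simp: quasilocal_def)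
  qed
qed

lemma v_quasilocal: "h \<in> H \<Longrightarrow> x \<in> \<int> \<Longrightarrow> v h x \<in> quasilocal"
  unfolding quasilocal_def
  by (rule UN_I[of "{x}"]) (simp_all add: finite_regions_def Ints_half_lattice v_local)

lemma w_quasilocal: "g \<in> carrier G \<Longrightarrow> l \<in> links \<Longrightarrow> w g l \<in> quasilocal"
  unfolding quasilocal_def
  by (rule UN_I[of "{l}"]) (simp_all add: finite_regions_def links_half_lattice w_local)

section \<open>The module of fields to the right of a site\<close>

text \<open>A finitely generated right module over the local observables; its generators are
  products of fields at the site \<open>a\<close> and the link to its left. It absorbs all local
  fields on regions to the right of \<open>a\<close>.\<close>

definition field_module :: "rat \<Rightarrow> 'a set" where
  "field_module a =
     span {\<delta> f a * \<rho> h (a - 1/2) * \<alpha> | f h \<alpha>. f \<in> carrier G \<and> h \<in> H \<and> \<alpha> \<in> quasilocal}"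

lemma field_module_base:
  "\<lbrakk>f \<in> carrier G; h \<in> H; \<alpha> \<in> quasilocal\<rbrakk> \<Longrightarrow> \<delta> f a * \<rho> h (a - 1/2) * \<alpha> \<in> field_module a"
  unfolding field_module_def by (rule span_base) blast

text \<open>Stability of the module is phrased through its multipliers because these form an
  algebra, so membership of a whole field algebra can be checked on generators.\<close>

definition left_multipliers :: "rat \<Rightarrow> 'a set" where
  "left_multipliers a = {y. \<forall>m\<in>field_module a. y * m \<in> field_module a}"

lemma left_multipliersI:
  assumes "\<And>f h \<alpha>. \<lbrakk>f \<in> carrier G; h \<in> H; \<alpha> \<in> quasilocal\<rbrakk>
    \<Longrightarrow> y * (\<delta> f a * \<rho> h (a - 1/2) * \<alpha>) \<in> field_module a"
  shows "y \<in> left_multipliers a"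
  unfolding left_multipliers_def
proof safe
  fix m assume "m \<in> field_module a"
  then show "y * m \<in> field_module a"
    unfolding field_module_def by (rule span_mult_left[rotated]) (use assms in \<open>auto simp: field_module_def\<close>)
qed

lemma unital_subalgebra_left_multipliers: "unital_subalgebra (left_multipliers a)"
proof -
  \<comment> \<open>Complex scalars are absorbed into the observable factor, since the span is
    real.\<close>
  have scale: "c *\<^sub>C m \<in> field_module a" if "m \<in> field_module a" for c m
  proof -
    have "c *\<^sub>C 1 \<in> left_multipliers a"
    proof (rule left_multipliersI)
      fix f h \<alpha> assume "f \<in> carrier G" "h \<in> H" "\<alpha> \<in> quasilocal"
      then show "c *\<^sub>C 1 * (\<delta> f a * \<rho> h (a - 1/2) * \<alpha>) \<in> field_module a"
        using field_module_base[of f h "c *\<^sub>C \<alpha>" a] unital_subalgebraD(4)[OF unital_subalgebra_quasilocal]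
        by (simp add: mult_scaleC_left mult_scaleC_right)
    qed
    then have "(c *\<^sub>C 1) * m \<in> field_module a" using that by (simp add: left_multipliers_def)
    then show ?thesis by (simp add: mult_scaleC_left)
  qed
  have "x + y \<in> field_module a" if "x \<in> field_module a" "y \<in> field_module a" for x y
    using that by (simp add: field_module_def span_add)
  with scale show ?thesis
    by (auto simp: unital_subalgebra_def left_multipliers_def distrib_right mult_scaleC_left mult.assoc)
qed

context
  fixes a :: rat
  assumes a: "a \<in> \<int>"
begin

text \<open>The deltas at \<open>a\<close> sum to 1, and \<rho> with trivial label is 1.\<close>

lemma one_field_module: "1 \<in> field_module a"
proof -
  have "(\<Sum>f\<in>carrier G. \<delta> f a * \<rho> \<one> (a - 1/2) * 1) \<in> field_module a"
    using field_module_base[OF _ H_one unital_subalgebraD(1)[OF unital_subalgebra_quasilocal]]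
    unfolding field_module_def by (rule span_sum)
  then show ?thesis using a by (simp add: rho_one link_simps delta_sum)
qed

lemma rho_left_multiplier: "k \<in> H \<Longrightarrow> \<rho> k (a - 1/2) \<in> left_multipliers a"
proof (rule left_multipliersI)
  fix f h \<alpha> assume *: "k \<in> H" "f \<in> carrier G" "h \<in> H" "\<alpha> \<in> quasilocal"
  then have "\<rho> k (a - 1/2) * (\<delta> f a * \<rho> h (a - 1/2) * \<alpha>)
      = (\<rho> k (a - 1/2) * \<delta> f a) * \<rho> h (a - 1/2) * \<alpha>" by (simp add: mult.assoc)
  also have "\<dots> = \<delta> (k \<otimes> f) a * (\<rho> k (a - 1/2) * \<rho> h (a - 1/2)) * \<alpha>"
    using * a by (simp add: rho_delta_less link_simps mult.assoc)
  also have "\<dots> = \<delta> (k \<otimes> f) a * \<rho> (k \<otimes> h) (a - 1/2) * \<alpha>"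
    using * a by (simp add: rho_rho link_simps)
  also have "\<dots> \<in> field_module a" using * by (intro field_module_base) (auto simp: mem_carrier)
  finally show "\<rho> k (a - 1/2) * (\<delta> f a * \<rho> h (a - 1/2) * \<alpha>) \<in> field_module a" .
qed

lemma delta_left_multiplier: "g \<in> carrier G \<Longrightarrow> \<delta> g a \<in> left_multipliers a"
proof (rule left_multipliersI)
  fix f h \<alpha> assume *: "g \<in> carrier G" "f \<in> carrier G" "h \<in> H" "\<alpha> \<in> quasilocal"
  have "\<delta> g a * (\<delta> f a * \<rho> h (a - 1/2) * \<alpha>) = (\<delta> g a * \<delta> f a) * \<rho> h (a - 1/2) * \<alpha>"
    by (simp add: mult.assoc)
  also have "\<dots> \<in> field_module a"
    using * a by (simp add: delta_delta field_module_base) (simp add: field_module_def span_zero)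
  finally show "\<delta> g a * (\<delta> f a * \<rho> h (a - 1/2) * \<alpha>) \<in> field_module a" .
qed

text \<open>\<open>w g l\<close> commutes with the two field factors and is then absorbed into the
  observable factor.\<close>

lemma w_left_multiplier:
  assumes g: "g \<in> carrier G" and l: "l \<in> links" "a < l"
  shows "w g l \<in> left_multipliers a"
proof (rule left_multipliersI)
  fix f h \<alpha> assume *: "f \<in> carrier G" "h \<in> H" "\<alpha> \<in> quasilocal"
  \<comment> \<open>The link \<open>a - 1/2\<close> lies strictly to the left of both sites of
    \<open>w g l\<close>, as \<open>rho_w\<close> requires.\<close>
  have "a \<le> l - 1/2" using a l by (auto simp: links_def Ints_def)
  then have "a - 1/2 < l - 1/2" by linarith
  then have "w g l * \<rho> h (a - 1/2) = \<rho> h (a - 1/2) * w g l"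
    using * g l a by (intro rho_w[symmetric]) (auto simp: link_simps)
  with delta_w[of f a g l] have "w g l * (\<delta> f a * \<rho> h (a - 1/2)) = \<delta> f a * \<rho> h (a - 1/2) * w g l"
    using * g l a by (intro intertwine_mult) auto
  then have "w g l * (\<delta> f a * \<rho> h (a - 1/2) * \<alpha>) = \<delta> f a * \<rho> h (a - 1/2) * (w g l * \<alpha>)"
    by (simp flip: mult.assoc)
  also have "\<dots> \<in> field_module a"
    using * g l unital_subalgebraD(3)[OF unital_subalgebra_quasilocal w_quasilocal]
    by (intro field_module_base)
  finally show "w g l * (\<delta> f a * \<rho> h (a - 1/2) * \<alpha>) \<in> field_module a" .
qed

text \<open>\<open>v k x\<close> passes the field factors and is absorbed by the observable one.
  Only for \<open>x = a\<close> does the label of \<delta> change, by right translation.\<close>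

lemma v_left_multiplier:
  assumes k: "k \<in> H" and x: "x \<in> \<int>" "a \<le> x"
  shows "v k x \<in> left_multipliers a"
proof (rule left_multipliersI)
  fix f h \<alpha> assume *: "f \<in> carrier G" "h \<in> H" "\<alpha> \<in> quasilocal"
  have kc: "k \<in> carrier G" using k by (rule mem_carrier)
  have rv: "\<rho> h (a - 1/2) * v k x = v k x * \<rho> h (a - 1/2)"
    using * k x a by (intro rho_v) (auto simp: link_simps)
  obtain f' where f': "f' \<in> carrier G" "v k x * \<delta> f a = \<delta> f' a * v k x"
  proof (cases "x = a")
    case True
    then show ?thesis using that[of "f \<otimes> inv k"] v_delta_shift[of k a f] * k kc a by simp
  next
    case False
    then show ?thesis using that[of f] delta_v_less[of k x f a] * k x a by simp
  qed
  have "v k x * (\<delta> f a * \<rho> h (a - 1/2) * \<alpha>) = (v k x * \<delta> f a) * \<rho> h (a - 1/2) * \<alpha>"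
    by (simp add: mult.assoc)
  also have "\<dots> = \<delta> f' a * (v k x * \<rho> h (a - 1/2)) * \<alpha>" by (simp add: f' mult.assoc)
  also have "\<dots> = \<delta> f' a * \<rho> h (a - 1/2) * (v k x * \<alpha>)" unfolding rv[symmetric] by (simp add: mult.assoc)
  also have "\<dots> \<in> field_module a"
    using * f' k x unital_subalgebraD(3)[OF unital_subalgebra_quasilocal v_quasilocal]
    by (intro field_module_base)
  finally show "v k x * (\<delta> f a * \<rho> h (a - 1/2) * \<alpha>) \<in> field_module a" .
qed

text \<open>Induction along the sites with \<open>delta_propagate\<close>; the new factor is a
  \<open>w\<close> at a link to the right of \<open>a\<close>.\<close>

lemma delta_left_multiplier_nat: "g \<in> carrier G \<Longrightarrow> \<delta> g (a + of_nat n) \<in> left_multipliers a"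
proof (induction n arbitrary: g)
  case 0
  then show ?case by (simp add: delta_left_multiplier)
next
  case (Suc n)
  have "\<delta> g (a + of_nat n + 1) \<in> left_multipliers a"
    using Suc a
    by (subst delta_propagate)
      (auto intro!: unital_subalgebra_sum unital_subalgebra_left_multipliers
        unital_subalgebraD(3)[OF unital_subalgebra_left_multipliers] w_left_multiplier simp: link_simps)
  then show ?case by (simp add: add.assoc add.commute[of 1])
qed

text \<open>Each induction step crosses the site \<open>a + of_nat n\<close> with
  \<open>rho_propagate\<close>. The first crossing is at \<open>a\<close> itself, the boundary case
  of \<open>v_left_multiplier\<close>.\<close>

lemma rho_left_multiplier_nat: "k \<in> H \<Longrightarrow> \<rho> k (a - 1/2 + of_nat n) \<in> left_multipliers a"
proof (induction n)
  case 0
  then show ?case by (simp add: rho_left_multiplier)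
next
  case (Suc n)
  have e: "a - 1/2 + of_nat n = a + of_nat n - 1/2" by simp
  have "\<rho> k (a + of_nat n + 1/2) \<in> left_multipliers a"
    using Suc a unfolding e
    by (subst rho_propagate)
      (auto intro!: unital_subalgebra_sum unital_subalgebra_left_multipliers inv_op_closed1
        unital_subalgebraD(3)[OF unital_subalgebra_left_multipliers] v_left_multiplier
        delta_left_multiplier_nat)
  moreover have "a - 1/2 + of_nat (Suc n) = a + of_nat n + 1/2" by simp
  ultimately show ?case by (simp only:)
qed

text \<open>All generators are left multipliers, hence so is the algebra; applying it to 1 gives the
  inclusion.\<close>

lemma field_local_subset_module:
  assumes "\<And>s. s \<in> \<Lambda> \<Longrightarrow> a \<le> s"
  shows "field_local G H \<delta> \<rho> \<Lambda> \<subseteq> field_module a"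
proof -
  have nat: "\<exists>n. s = a + of_nat n" if "s \<in> \<int>" "a \<le> s" for s
  proof -
    have "s - a \<in> \<int>" using that a by simp
    then obtain z where z: "s - a = of_int z" by (auto simp: Ints_def)
    then have "0 \<le> z" using that by (metis diff_ge_0_iff_ge of_int_0_le_iff)
    then show ?thesis using z by (intro exI[of _ "nat z"]) (simp add: algebra_simps)
  qed
  have "field_local G H \<delta> \<rho> \<Lambda> \<subseteq> left_multipliers a"
    unfolding field_local_def
  proof (rule hull_minimal[where S = unital_subalgebra, OF _ unital_subalgebra_left_multipliers], safe)
    fix g x assume "g \<in> carrier G" "x \<in> \<Lambda>" "x \<in> (\<int>::rat set)"
    then show "\<delta> g x \<in> left_multipliers a"
      using nat[of x] assms delta_left_multiplier_nat by blast
  next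
    fix h l assume *: "h \<in> H" "l \<in> \<Lambda>" "l \<in> links"
    \<comment> \<open>Links are counted from \<open>a - 1/2\<close>, so the natural number comes
      from the site to the right of \<open>l\<close>.\<close>
    then obtain n where "l + 1/2 = a + of_nat n"
      using nat[of "l + 1/2"] assms[of l] by (auto simp: link_simps)
    then have "l = a - 1/2 + of_nat n" by linarith
    then show "\<rho> h l \<in> left_multipliers a" using rho_left_multiplier_nat * by blast
  qed
  then show ?thesis using one_field_module by (fastforce simp: left_multipliers_def)
qed

end

end

section \<open>The action and its fixed points\<close>

text \<open>Conjugation is multiplicative. In this form the lemma identifies the only degree at
  which a product of two homogeneous elements survives.\<close>

lemma (in group) conj_eq_iff:
  assumes "a \<in> carrier G" "b \<in> carrier G" "h \<in> carrier G" "g \<in> carrier G"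
  shows "inv (g \<otimes> a \<otimes> inv g) \<otimes> h = g \<otimes> b \<otimes> inv g \<longleftrightarrow> h = g \<otimes> (a \<otimes> b) \<otimes> inv g"
proof -
  have "inv (g \<otimes> a \<otimes> inv g) \<otimes> h = g \<otimes> b \<otimes> inv g
      \<longleftrightarrow> h = (g \<otimes> a \<otimes> inv g) \<otimes> (g \<otimes> b \<otimes> inv g)"
    using assms by (metis inv_solve_left m_closed inv_closed)
  moreover have "(g \<otimes> a \<otimes> inv g) \<otimes> (g \<otimes> b \<otimes> inv g) = g \<otimes> a \<otimes> (inv g \<otimes> g) \<otimes> b \<otimes> inv g"
    using assms by (simp only: m_assoc m_closed inv_closed)
  ultimately show ?thesis using assms by (simp add: m_assoc)
qed

locale field_action = field_algebra H G \<delta> \<rho>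
  for H :: "'g set" and G :: "('g, 'm) monoid_scheme" (structure)
    and \<delta> \<rho> :: "'g \<Rightarrow> rat \<Rightarrow> 'a::unital_cstar_algebra" +
  fixes act :: "'g dbl \<Rightarrow> 'a \<Rightarrow> 'a"
  assumes field_action: "is_field_action G H \<delta> \<rho> act"
begin

abbreviation basis_act :: "'g \<Rightarrow> 'g \<Rightarrow> 'a \<Rightarrow> 'a" where
  "basis_act h g \<equiv> act (dbl_basis (h, g))"

section \<open>The conditions on the action, one by one\<close>

lemma act_add [rule_format]:
  "\<forall>a\<in>dbl_carrier G H. \<forall>F F'. act a (F + F') = act a F + act a F'"
  using field_action unfolding is_field_action_def by (elim conjE)

lemma act_scaleC [rule_format]:
  "\<forall>a\<in>dbl_carrier G H. \<forall>c F. act a (c *\<^sub>C F) = c *\<^sub>C act a F"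
  using field_action unfolding is_field_action_def by (elim conjE)

lemma act_add_left [rule_format]:
  "\<forall>a\<in>dbl_carrier G H. \<forall>b\<in>dbl_carrier G H. \<forall>F. act (\<lambda>p. a p + b p) F = act a F + act b F"
  using field_action unfolding is_field_action_def by (elim conjE)

lemma act_scale_left [rule_format]:
  "\<forall>a\<in>dbl_carrier G H. \<forall>c F. act (\<lambda>p. c * a p) F = c *\<^sub>C act a F"
  using field_action unfolding is_field_action_def by (elim conjE)

lemma act_dbl_mult [rule_format]:
  "\<forall>a\<in>dbl_carrier G H. \<forall>b\<in>dbl_carrier G H. \<forall>F. act (dbl_mult G H a b) F = act a (act b F)"
  using field_action unfolding is_field_action_def by (elim conjE)

lemma act_mult [rule_format]:
  "\<forall>a\<in>dbl_carrier G H. \<forall>F F'. act a (F * F') =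
    (\<Sum>p\<in>H \<times> carrier G. \<Sum>q\<in>H \<times> carrier G.
      dbl_comult G H a (p, q) *\<^sub>C (act (dbl_basis p) F * act (dbl_basis q) F'))"
  using field_action unfolding is_field_action_def by (elim conjE)

lemma act_one [rule_format]:
  "\<forall>a\<in>dbl_carrier G H. act a 1 = dbl_counit G H a *\<^sub>C 1"
  using field_action unfolding is_field_action_def by (elim conjE)

lemma continuous_act [rule_format]:
  "\<forall>a\<in>dbl_carrier G H. continuous_on UNIV (act a)"
  using field_action unfolding is_field_action_def by (elim conjE)

lemma basis_act_delta [rule_format]:
  "\<forall>h\<in>H. \<forall>g\<in>carrier G. \<forall>f\<in>carrier G. \<forall>x\<in>\<int>.
    basis_act h g (\<delta> f x) = (if h = \<one> then \<delta> (g \<otimes> f) x else 0)"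
  using field_action unfolding is_field_action_def by (elim conjE)

lemma basis_act_rho [rule_format]:
  "\<forall>h\<in>H. \<forall>g\<in>carrier G. \<forall>t\<in>H. \<forall>l\<in>links.
    basis_act h g (\<rho> t l) = (if h = g \<otimes> t \<otimes> inv g then \<rho> h l else 0)"
  using field_action unfolding is_field_action_def by (elim conjE)

lemma basis_carrier: "h \<in> H \<Longrightarrow> g \<in> carrier G \<Longrightarrow> dbl_basis (h, g) \<in> dbl_carrier G H"
  by (auto simp: dbl_basis_def dbl_carrier_def)

lemma act_zero_left: "act (\<lambda>p. 0) F = 0"
  using act_scale_left[of "\<lambda>p. 0" 0 F] by (simp add: dbl_carrier_def)

lemma act_sum_left:
  assumes "finite A" and "\<And>i. i \<in> A \<Longrightarrow> a i \<in> dbl_carrier G H"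
  shows "act (\<lambda>p. \<Sum>i\<in>A. a i p) F = (\<Sum>i\<in>A. act (a i) F)"
  using assms
proof (induction A)
  case (insert i A)
  have "(\<lambda>p. \<Sum>i\<in>A. a i p) \<in> dbl_carrier G H"
    using insert.prems by (auto simp: dbl_carrier_def intro!: sum.neutral)
  then show ?case using insert by (simp add: act_add_left)
qed (simp add: act_zero_left)

abbreviation z where "z \<equiv> z_elt G"

lemma z_carrier: "z \<in> dbl_carrier G H"
  unfolding z_elt_def dbl_carrier_def dbl_basis_def by (auto intro!: sum.neutral)

lemma act_z: "act z F = (1 / of_nat (card (carrier G))) *\<^sub>C (\<Sum>g\<in>carrier G. basis_act \<one> g F)"
proof -
  have "(\<lambda>q. \<Sum>g\<in>carrier G. dbl_basis (\<one>, g) q) \<in> dbl_carrier G H"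
    unfolding dbl_carrier_def dbl_basis_def by (auto intro!: sum.neutral)
  then show ?thesis
    unfolding z_elt_def
    by (simp only: act_scale_left act_sum_left[OF finite_carrier basis_carrier[OF H_one]])
qed

lemma card_carrier [simp]: "card (carrier G) \<noteq> 0"
  using finite_carrier one_closed by (metis card_0_eq empty_iff)

section \<open>Products and coproducts of basis elements\<close>

lemma act_basis_basis:
  assumes h: "h \<in> H" "h' \<in> H" and g: "g \<in> carrier G" "g' \<in> carrier G"
  shows "basis_act h g (basis_act h' g' F) = (if h \<otimes> g = g \<otimes> h' then basis_act h (g \<otimes> g') F else 0)"
proof -
  have fin: "finite (H \<times> carrier G)" using finite_H finite_carrier by simp
  let ?u = "\<lambda>p p' q. if fst p \<otimes> snd p = snd p \<otimes> fst p' then dbl_basis (fst p, snd p \<otimes> snd p') q else 0"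
  have "dbl_mult G H (dbl_basis (h, g)) (dbl_basis (h', g')) =
      (\<lambda>q. if h \<otimes> g = g \<otimes> h' then dbl_basis (h, g \<otimes> g') q else 0)"
  proof
    fix q
    have "dbl_mult G H (dbl_basis (h, g)) (dbl_basis (h', g')) q
        = (\<Sum>p\<in>H \<times> carrier G. \<Sum>p'\<in>H \<times> carrier G.
            if p = (h, g) then if p' = (h', g') then ?u p p' q else 0 else 0)"
      unfolding dbl_mult_def split_def by (intro sum.cong refl) (auto simp: dbl_basis_def)
    also have "\<dots> = (\<Sum>p\<in>H \<times> carrier G. if p = (h, g) then ?u (h, g) (h', g') q else 0)"
      using assms by (intro sum.cong refl) (auto simp: sum.delta[OF fin])
    also have "\<dots> = ?u (h, g) (h', g') q"
      using assms by (simp add: sum.delta[OF fin])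
    finally show "dbl_mult G H (dbl_basis (h, g)) (dbl_basis (h', g')) q
        = (if h \<otimes> g = g \<otimes> h' then dbl_basis (h, g \<otimes> g') q else 0)" by simp
  qed
  then show ?thesis
    using assms act_dbl_mult[OF basis_carrier[OF h(1) g(1)] basis_carrier[OF h(2) g(2)], of F]
    by (cases "h \<otimes> g = g \<otimes> h'") (simp_all add: act_zero_left)
qed

lemma basis_act_mult:
  assumes h: "h \<in> H" and g: "g \<in> carrier G"
  shows "basis_act h g (F * F') = (\<Sum>t\<in>H. basis_act t g F * basis_act (inv t \<otimes> h) g F')"
proof -
  have fin: "finite (H \<times> carrier G)" using finite_H finite_carrier by simp
  let ?X = "\<lambda>p q. act (dbl_basis p) F * act (dbl_basis q) F'"
  have comult: "dbl_comult G H (dbl_basis (h, g)) (p, q) =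
      (\<Sum>t\<in>H. (if p = (t, g) then 1 else 0) * (if q = (inv t \<otimes> h, g) then 1 else 0))" for p q
  proof -
    have "dbl_comult G H (dbl_basis (h, g)) (p, q) = (\<Sum>r\<in>H \<times> carrier G. if r = (h, g) then
        (\<Sum>t\<in>H. dbl_basis (t, g) p * dbl_basis (inv t \<otimes> h, g) q) else 0)"
      unfolding dbl_comult_def split_def prod.sel
      by (intro sum.cong refl) (auto simp: dbl_basis_def)
    also have "\<dots> = (\<Sum>t\<in>H. dbl_basis (t, g) p * dbl_basis (inv t \<otimes> h, g) q)"
      using h g by (simp add: sum.delta[OF fin])
    finally show ?thesis by (simp add: dbl_basis_def)
  qed
  have "basis_act h g (F * F') = (\<Sum>p\<in>H \<times> carrier G. \<Sum>q\<in>H \<times> carrier G. \<Sum>t\<in>H.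
      if q = (inv t \<otimes> h, g) then if p = (t, g) then ?X (t, g) (inv t \<otimes> h, g) else 0 else 0)"
    unfolding act_mult[OF basis_carrier[OF h g]] comult scaleC_sum_left
    by (intro sum.cong refl) auto
  \<comment> \<open>For given \<open>t\<close> exactly one \<open>p\<close> and one \<open>q\<close>
    contribute; interchanging the sums lets both collapse.\<close>
  also have "\<dots> = (\<Sum>p\<in>H \<times> carrier G. \<Sum>t\<in>H. \<Sum>q\<in>H \<times> carrier G.
      if q = (inv t \<otimes> h, g) then if p = (t, g) then ?X (t, g) (inv t \<otimes> h, g) else 0 else 0)"
    by (rule sum.cong[OF refl], rule sum.swap)
  also have "\<dots> = (\<Sum>p\<in>H \<times> carrier G. \<Sum>t\<in>H. if p = (t, g) then ?X (t, g) (inv t \<otimes> h, g) else 0)"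
    using h g by (intro sum.cong refl) (simp add: sum.delta[OF fin])
  also have "\<dots> = (\<Sum>t\<in>H. \<Sum>p\<in>H \<times> carrier G. if p = (t, g) then ?X (t, g) (inv t \<otimes> h, g) else 0)"
    by (rule sum.swap)
  also have "\<dots> = (\<Sum>t\<in>H. ?X (t, g) (inv t \<otimes> h, g))"
    using g by (intro sum.cong refl) (simp add: sum.delta[OF fin])
  finally show ?thesis .
qed

section \<open>Covariant elements\<close>

text \<open>\<open>F\<close> has degree \<open>d\<close> for the \<open>H\<close>-grading, and \<open>\<phi> g\<close>, of degree \<open>g d g\<inverse>\<close>, is its image under \<open>g\<close>.\<close>

definition covariant :: "'a \<Rightarrow> 'g \<Rightarrow> ('g \<Rightarrow> 'a) \<Rightarrow> bool" where
  "covariant F d \<phi> \<longleftrightarrow>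
    (\<forall>h\<in>H. \<forall>g\<in>carrier G. basis_act h g F = (if h = g \<otimes> d \<otimes> inv g then \<phi> g else 0))"

lemma covariantD:
  "\<lbrakk>covariant F d \<phi>; h \<in> H; g \<in> carrier G\<rbrakk> \<Longrightarrow>
    basis_act h g F = (if h = g \<otimes> d \<otimes> inv g then \<phi> g else 0)"
  by (simp add: covariant_def)

lemma covariant_delta: "f \<in> carrier G \<Longrightarrow> x \<in> \<int> \<Longrightarrow> covariant (\<delta> f x) \<one> (\<lambda>g. \<delta> (g \<otimes> f) x)"
  by (simp add: covariant_def basis_act_delta)

lemma covariant_rho: "t \<in> H \<Longrightarrow> l \<in> links \<Longrightarrow> covariant (\<rho> t l) t (\<lambda>g. \<rho> (g \<otimes> t \<otimes> inv g) l)"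
  by (simp add: covariant_def basis_act_rho)

text \<open>Of the coproduct sum only the degree of the first factor, conjugated by
  \<open>g\<close>, survives; \<open>conj_eq_iff\<close> then shows that degrees multiply.\<close>

lemma covariant_mult:
  assumes F: "covariant F d \<phi>" "d \<in> H" and F': "covariant F' d' \<phi>'" "d' \<in> H"
  shows "covariant (F * F') (d \<otimes> d') (\<lambda>g. \<phi> g * \<phi>' g)"
  unfolding covariant_def
proof (intro ballI)
  fix h g assume h: "h \<in> H" and g: "g \<in> carrier G"
  let ?t = "g \<otimes> d \<otimes> inv g"
  have t: "?t \<in> H" using F g by (simp add: inv_op_closed2)
  have "basis_act h g (F * F') = (\<Sum>t\<in>H. if t = ?t then \<phi> g * basis_act (inv ?t \<otimes> h) g F' else 0)"
    unfolding basis_act_mult[OF h g] using g by (intro sum.cong refl) (auto simp: covariantD[OF F(1)])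
  also have "\<dots> = \<phi> g * basis_act (inv ?t \<otimes> h) g F'"
    using t by (simp add: sum.delta[OF finite_H])
  also have "\<dots> = (if inv ?t \<otimes> h = g \<otimes> d' \<otimes> inv g then \<phi> g * \<phi>' g else 0)"
    using t h g by (simp add: covariantD[OF F'(1)])
  also have "\<dots> = (if h = g \<otimes> (d \<otimes> d') \<otimes> inv g then \<phi> g * \<phi>' g else 0)"
    using F F' h g by (subst conj_eq_iff) (auto simp: mem_carrier)
  finally show "basis_act h g (F * F') = (if h = g \<otimes> (d \<otimes> d') \<otimes> inv g then \<phi> g * \<phi>' g else 0)" .
qed

lemma basis_act_sum:
  "h \<in> H \<Longrightarrow> g \<in> carrier G \<Longrightarrow> basis_act h g (sum F A) = (\<Sum>i\<in>A. basis_act h g (F i))"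
  using act_scaleC[OF basis_carrier, of h g 0 0]
  by (induction A rule: infinite_finite_induct) (simp_all add: act_add basis_carrier)

lemma covariant_sum:
  assumes "\<And>i. i \<in> A \<Longrightarrow> covariant (F i) d (\<phi> i)"
  shows "covariant (sum F A) d (\<lambda>g. \<Sum>i\<in>A. \<phi> i g)"
  using assms by (simp add: covariant_def basis_act_sum sum.neutral)

section \<open>Fixed points of \<open>z\<close>\<close>

abbreviation observables where "observables \<equiv> observable_algebra G act"

text \<open>\<open>z\<close> is a left integral: the product of \<open>(h, g)\<close> with
  \<open>z\<close> is \<open>z\<close> if \<open>h = \<one>\<close> and zero otherwise. So a fixed
  point of \<open>z\<close> has degree \<open>\<one>\<close> and is fixed by \<open>G\<close>;
  conversely, averaging the constant family returns \<open>F\<close>.\<close>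

lemma observable_iff: "F \<in> observables \<longleftrightarrow> covariant F \<one> (\<lambda>_. F)"
proof
  assume "covariant F \<one> (\<lambda>_. F)"
  then have "act z F = (1 / of_nat (card (carrier G))) *\<^sub>C (\<Sum>g\<in>carrier G. 1 *\<^sub>C F)"
    by (simp add: act_z covariantD)
  also have "\<dots> = F"
    unfolding scaleC_sum_left[symmetric] scaleC_scaleC by simp
  finally show "F \<in> observables" by (simp add: observable_algebra_def)
next
  assume "F \<in> observables"
  then have zF: "act z F = F" by (simp add: observable_algebra_def)
  show "covariant F \<one> (\<lambda>_. F)"
    unfolding covariant_def
  proof (intro ballI)
    fix h g assume h: "h \<in> H" and g: "g \<in> carrier G"
    have hg: "h \<otimes> g = g \<longleftrightarrow> h = \<one>" using h g by (simp add: mem_carrier)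
    have "basis_act h g F = basis_act h g (act z F)" by (simp add: zF)
    also have "\<dots> = (1 / of_nat (card (carrier G))) *\<^sub>C
        (\<Sum>g'\<in>carrier G. if h = \<one> then basis_act \<one> (g \<otimes> g') F else 0)"
      unfolding act_z act_scaleC[OF basis_carrier[OF h g]] basis_act_sum[OF h g]
      using h g hg by (intro arg_cong2[of _ _ _ _ scaleC] refl sum.cong) (auto simp: act_basis_basis)
    also have "\<dots> = (if h = \<one> then act z F else 0)"
      unfolding act_z using sum_shift_left[OF g, of "\<lambda>g. basis_act \<one> g F"] by simp
    finally show "basis_act h g F = (if h = g \<otimes> \<one> \<otimes> inv g then F else 0)"
      using g by (simp add: zF)
  qed
qed

lemma unital_subalgebra_observables: "unital_subalgebra observables"
  unfolding unital_subalgebra_def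
proof (intro conjI ballI allI)
  \<comment> \<open>\<open>z\<close> acts on the unit by its counit.\<close>
  have "dbl_counit G H z = 1"
  proof -
    have "dbl_counit G H z = (\<Sum>h\<in>H. \<Sum>g\<in>carrier G. if h = \<one> then 1 / of_nat (card (carrier G)) else 0)"
      unfolding dbl_counit_def sum.cartesian_product[symmetric] z_elt_def dbl_basis_def
      using finite_carrier by (intro sum.cong refl) (auto simp: sum.delta')
    also have "\<dots> = (\<Sum>h\<in>H. if h = \<one> then 1 else 0)"
      by (intro sum.cong refl) simp
    finally show ?thesis using finite_H by simp
  qed
  then show "1 \<in> observables" by (simp add: observable_algebra_def act_one z_carrier)
  show "x + y \<in> observables" if "x \<in> observables" "y \<in> observables" for x y
    using that by (simp add: observable_algebra_def act_add z_carrier)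
  show "c *\<^sub>C x \<in> observables" if "x \<in> observables" for x c
    using that by (simp add: observable_algebra_def act_scaleC z_carrier)
  show "x * y \<in> observables" if "x \<in> observables" "y \<in> observables" for x y
    using that covariant_mult[of x \<one> _ y \<one>] by (simp add: observable_iff)
qed

lemma closed_observables: "closed observables"
  unfolding observable_algebra_def
  by (intro closed_Collect_eq continuous_act z_carrier continuous_intros)

text \<open>An observable has degree \<open>\<one>\<close> and is fixed by \<open>G\<close>, so only
  \<open>t = \<one>\<close> contributes to the coproduct sum. This is the module property of a
  conditional expectation.\<close>

lemma act_z_mult_observable:
  assumes "\<alpha> \<in> observables" shows "act z (F * \<alpha>) = act z F * \<alpha>"
proof -
  have "basis_act \<one> g (F * \<alpha>) = basis_act \<one> g F * \<alpha>" if g: "g \<in> carrier G" for g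
  proof -
    have eq: "inv t \<otimes> \<one> = \<one> \<longleftrightarrow> t = \<one>" if "t \<in> H" for t
      using that by (simp add: mem_carrier inv_eq_1_iff)
    have "basis_act \<one> g (F * \<alpha>) = (\<Sum>t\<in>H. if t = \<one> then basis_act \<one> g F * \<alpha> else 0)"
      unfolding basis_act_mult[OF H_one g]
    proof (rule sum.cong)
      fix t assume t: "t \<in> H"
      then have "basis_act (inv t \<otimes> \<one>) g \<alpha> = (if inv t \<otimes> \<one> = \<one> then \<alpha> else 0)"
        using assms g covariantD[of \<alpha> \<one> "\<lambda>_. \<alpha>" "inv t \<otimes> \<one>" g] by (simp add: observable_iff)
      then show "basis_act t g F * basis_act (inv t \<otimes> \<one>) g \<alpha> = (if t = \<one> then basis_act \<one> g F * \<alpha> else 0)"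
        unfolding eq[OF t] by simp
    qed simp
    then show ?thesis by (simp add: sum.delta[OF finite_H])
  qed
  then show ?thesis by (simp add: act_z mult_scaleC_left sum_distrib_right)
qed

text \<open>In each term the degrees of the two link factors cancel, and \<open>g\<close> carries
  the term with index \<open>f\<close> to the one with index \<open>g \<otimes> f\<close>, so the
  sum is fixed.\<close>

lemma v_observable:
  assumes h: "h \<in> H" and x: "x \<in> \<int>" shows "v h x \<in> observables"
proof -
  have hc: "h \<in> carrier G" using h by (rule mem_carrier)
  let ?t = "\<lambda>f. \<rho> (f \<otimes> inv h \<otimes> inv f) (x - 1/2) * \<delta> f x * \<rho> (f \<otimes> h \<otimes> inv f) (x + 1/2)"
  have "covariant (?t f) \<one> (\<lambda>g. ?t (g \<otimes> f))" if f: "f \<in> carrier G" for f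
  proof -
    let ?p = "f \<otimes> h \<otimes> inv f" and ?q = "f \<otimes> inv h \<otimes> inv f"
    have pq: "?p \<in> H" "?q \<in> H" using h f by (auto simp: inv_op_closed2)
    have c: "covariant (?t f) (?q \<otimes> \<one> \<otimes> ?p) (\<lambda>g. \<rho> (g \<otimes> ?q \<otimes> inv g) (x - 1/2) * \<delta> (g \<otimes> f) x
        * \<rho> (g \<otimes> ?p \<otimes> inv g) (x + 1/2))"
      using pq f x by (intro covariant_mult covariant_rho covariant_delta) (auto simp: link_simps)
    have "?q \<otimes> \<one> \<otimes> ?p = \<one>"
      using f hc inv_conj[of f h] l_inv[of ?p] by simp
    moreover have "g \<otimes> ?q \<otimes> inv g = g \<otimes> f \<otimes> inv h \<otimes> inv (g \<otimes> f)"
      "g \<otimes> ?p \<otimes> inv g = g \<otimes> f \<otimes> h \<otimes> inv (g \<otimes> f)" if "g \<in> carrier G" for g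
      using that f hc by (simp_all add: m_assoc inv_mult_group)
    ultimately show ?thesis using c by (simp add: covariant_def)
  qed
  then have "covariant (v h x) \<one> (\<lambda>g. \<Sum>f\<in>carrier G. ?t (g \<otimes> f))"
    unfolding v_op_def by (rule covariant_sum)
  moreover have "(\<Sum>f\<in>carrier G. ?t (g \<otimes> f)) = v h x" if "g \<in> carrier G" for g
    unfolding v_op_def by (rule sum_shift_left[OF that])
  ultimately show ?thesis by (simp add: observable_iff covariant_def)
qed

text \<open>Deltas have degree \<open>\<one>\<close>, and \<open>g\<close> permutes the terms by
  left translation.\<close>

lemma w_observable:
  assumes k: "k \<in> carrier G" and l: "l \<in> links" shows "w k l \<in> observables"
proof -
  let ?t = "\<lambda>f. \<delta> f (l - 1/2) * \<delta> (f \<otimes> k) (l + 1/2)"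
  have "covariant (?t f) \<one> (\<lambda>g. ?t (g \<otimes> f))" if f: "f \<in> carrier G" for f
  proof -
    have "covariant (?t f) (\<one> \<otimes> \<one>) (\<lambda>g. \<delta> (g \<otimes> f) (l - 1/2) * \<delta> (g \<otimes> (f \<otimes> k)) (l + 1/2))"
      using k f l by (intro covariant_mult covariant_delta) (auto simp: link_simps)
    then show ?thesis using f k by (simp add: covariant_def m_assoc)
  qed
  then have "covariant (w k l) \<one> (\<lambda>g. \<Sum>f\<in>carrier G. ?t (g \<otimes> f))"
    unfolding w_op_def by (rule covariant_sum)
  moreover have "(\<Sum>f\<in>carrier G. ?t (g \<otimes> f)) = w k l" if "g \<in> carrier G" for g
    unfolding w_op_def by (rule sum_shift_left[OF that])
  ultimately show ?thesis by (simp add: observable_iff covariant_def)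
qed

section \<open>\<open>z\<close> maps local fields to local observables\<close>

lemma quasilocal_observable: "quasilocal \<subseteq> observables"
  unfolding quasilocal_def observable_local_def
  by (intro UN_least hull_minimal[where S = unital_subalgebra, OF _ unital_subalgebra_observables])
    (auto simp: v_observable w_observable)

text \<open>\<open>z\<close> annihilates a generator unless \<open>h = \<one>\<close>. In that case
  the translates of \<delta> sum to 1 and the average is the observable factor divided by the order
  of \<open>G\<close>.\<close>

lemma act_z_field_module:
  assumes a: "a \<in> \<int>" and m: "m \<in> field_module a"
  shows "act z m \<in> quasilocal"
  using m unfolding field_module_def
proof (induction rule: span_induct_alt)
  case base
  show ?case
    using act_scaleC[OF z_carrier, of 0 0] unital_subalgebra_zero[OF unital_subalgebra_quasilocal] by simp
next
  case (step c x y)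
  then obtain f h \<alpha> where x: "x = \<delta> f a * \<rho> h (a - 1/2) * \<alpha>" "f \<in> carrier G" "h \<in> H" "\<alpha> \<in> quasilocal"
    by blast
  have hc: "h \<in> carrier G" using x by (simp add: mem_carrier)
  let ?c = "if h = \<one> then 1 / of_nat (card (carrier G)) else 0"
  have cov: "covariant (\<delta> f a * \<rho> h (a - 1/2)) (\<one> \<otimes> h)
      (\<lambda>g. \<delta> (g \<otimes> f) a * \<rho> (g \<otimes> h \<otimes> inv g) (a - 1/2))"
    using x a by (intro covariant_mult covariant_rho covariant_delta) (auto simp: link_simps)
  have conj1: "\<one> = g \<otimes> h \<otimes> inv g \<longleftrightarrow> h = \<one>" if "g \<in> carrier G" for g
    using inv_solve_right[of \<one> "g \<otimes> h" g] that hc by simp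
  have "(\<Sum>g\<in>carrier G. basis_act \<one> g (\<delta> f a * \<rho> h (a - 1/2)))
      = (\<Sum>g\<in>carrier G. if h = \<one> then \<delta> (g \<otimes> f) a else 0)"
    using a x hc by (intro sum.cong refl) (auto simp: covariantD[OF cov] conj1 rho_one link_simps)
  also have "\<dots> = (if h = \<one> then 1 else 0)"
    using sum_shift_right[OF x(2), of "\<lambda>g. \<delta> g a"] a by (simp add: delta_sum)
  finally have "act z (\<delta> f a * \<rho> h (a - 1/2)) = ?c *\<^sub>C 1" by (simp add: act_z)
  then have "act z x = ?c *\<^sub>C \<alpha>"
    using act_z_mult_observable[of \<alpha> "\<delta> f a * \<rho> h (a - 1/2)"] quasilocal_observable x
    by (auto simp: mult_scaleC_left)
  \<comment> \<open>Span induction produces real scalars, whereas the action is known to be complex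
    linear.\<close>
  then have "act z (c *\<^sub>R x + y) = complex_of_real c *\<^sub>C ?c *\<^sub>C \<alpha> + act z y"
    by (simp only: scaleR_scaleC act_add act_scaleC z_carrier)
  then show ?case
    using step x unital_subalgebraD(2,4)[OF unital_subalgebra_quasilocal] by (simp only:)
qed

lemma act_z_field_local: "F \<in> field_local G H \<delta> \<rho> (interval n) \<Longrightarrow> act z F \<in> quasilocal"
proof (rule act_z_field_module)
  let ?a = "- of_nat n - 1 :: rat"
  show "?a \<in> \<int>" by simp
  \<comment> \<open>Any integer to the left of the interval would do; its left end is at least
    \<open>- of_nat (n div 2) - 1/2\<close>.\<close>
  have "?a \<le> s" if "s \<in> interval n" for s
  proof -
    have "(of_nat (n div 2) :: rat) \<le> of_nat n" by simp
    then show ?thesis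
      using that unfolding interval_def interval_even_def interval_odd_def
      by (auto split: if_splits)
  qed
  then show "F \<in> field_module ?a" if "F \<in> field_local G H \<delta> \<rho> (interval n)"
    using field_local_subset_module[of ?a "interval n"] that by auto
qed

section \<open>Passage to the norm closure\<close>

text \<open>A fixed point is its own image under \<open>z\<close>. Local fields are dense and
  \<open>z\<close> sends them to local observables, so by continuity every image under
  \<open>z\<close> is a limit of local observables.\<close>

lemma observables_eq_closure: "observables = closure quasilocal"
proof
  show "closure quasilocal \<subseteq> observables"
    using quasilocal_observable closed_observables by (rule closure_minimal)
  show "observables \<subseteq> closure quasilocal"
  proof
    fix F assume "F \<in> observables"
    then have "act z F = F" by (simp add: observable_algebra_def)
    moreover have "act z ` closure (\<Union>n. field_local G H \<delta> \<rho> (interval n)) \<subseteq> closure quasilocal"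
      using continuous_act[OF z_carrier]
      by (intro image_closure_subset)
        (auto intro: continuous_on_subset subsetD[OF closure_subset] act_z_field_local)
    ultimately show "F \<in> closure quasilocal" unfolding field_local_dense by (metis UNIV_I image_subset_iff)
  qed
qed

text \<open>The description as a closure is used: the involution is continuous and preserves each
  local algebra.\<close>

lemma observables_adj:
  assumes "F \<in> observables" shows "F\<^sup>\<star> \<in> observables"
proof -
  have "adj ` closure quasilocal \<subseteq> closure quasilocal"
    using local_adj
    by (intro image_closure_subset continuous_on_adj)
      (auto simp: quasilocal_def intro!: subsetD[OF closure_subset])
  then show ?thesis using assms unfolding observables_eq_closure by blast
qed

end

theorem theorem2p1:
  fixes G :: "('g, 'm) monoid_scheme"
    and H :: "'g set"
    and \<delta> \<rho> :: "'g \<Rightarrow> rat \<Rightarrow> 'a::unital_cstar_algebra"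
    and act :: "('g \<times> 'g \<Rightarrow> complex) \<Rightarrow> 'a \<Rightarrow> 'a"
  assumes "group G" and "finite (carrier G)" and "H \<lhd> G"
    and "is_field_algebra G H \<delta> \<rho>"
    and "is_field_action G H \<delta> \<rho> act"
  shows "cstar_subalgebra (observable_algebra G act) \<and>
    cstar_directed_system finite_regions (observable_local G H \<delta> \<rho>) \<and>
    observable_algebra G act = cstar_inductive_limit finite_regions (observable_local G H \<delta> \<rho>)"
proof -
  interpret field_action H G \<delta> \<rho> act
    using assms by (simp add: field_action_def field_action_axioms_def
        field_algebra_def field_algebra_axioms_def)
  show ?thesis
    using unital_subalgebra_observables observables_adj closed_observables directed_system
      observables_eq_closure
    by (simp add: cstar_subalgebra_def cstar_inductive_limit_def quasilocal_def)
qed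

end
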